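(* For all integers $m,n$, $$ q^{-\frac{(\nu+m)n}{2}}\, J^{(3)}_{\nu+m}\big(xq^{\frac n2};q\big) = R^{(3)}_{m,n,\nu}(x;q)\, J^{(3)}_\nu(x;q) - R^{(3)}_{m-1,n,\nu+1}(x;q)\, J^{(3)}_{\nu-1}(x;q), $$ where $$ R^{(3)}_{m,n,\nu}(x;q) := \frac{(q^{\nu+m+1};q)_\infty}{(q^{\nu-1};q)_\infty}\, q^{-\max\{m+1,0\}}\left(\frac x2\right)^{\min\{m+2,\,-m\}} P^{(3)}_{m+1,n,\nu}(x;q), $$ and $P^{(3)}_{m,n,\nu}(x;q)$ is the explicit polynomial defined in the context, which is a polynomial in $x^2$ of degree at most $\max\{|n|,|m-n|\}-1$.
   Context: Here $0<q<1$. The $q$-shifted factorials are $(a;q)_0=1$, $(a;q)_j=(1-a)(1-aq)\cdots(1-aq^{j-1})$ for $j\ge 1$, $(a;q)_{-j}=1/(aq^{-j};q)_j=\frac{1}{(1-aq^{-1})\cdots(1-aq^{-j})}$ for $j\ge1$, and $(a;q)_\infty=\prod_{j\ge0}(1-aq^j)$. In particular $1/(q;q)_j=(q^{j+1};q)_{-j}=0$ for $j<0$. The basic hypergeometric series is $$ {}_r\phi_s(a_1,\dots,a_r;b_1,\dots,b_s;q,x)=\sum_{j=0}^\infty \frac{(a_1;q)_j\cdots(a_r;q)_j}{(q;q)_j(b_1;q)_j\cdots(b_s;q)_j}\Big\{(-1)^jq^{\binom j2}\Big\}^{1+s-r}x^j,\qquad \binom j2=\frac{j(j-1)}2, $$ where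 no lower parameter $b_i$ equals $1$ or a negative integer power of $q$. Throughout, parameters take values in the region where the series converge and the rational functions involved are defined. Jackson's third $q$-Bessel function is $$ J^{(3)}_\nu(x;q):=\frac{(q^{\nu+1};q)_\infty}{(q;q)_\infty}\left(\frac x2\right)^\nu {}_1\phi_1\Big(0;\,q^{\nu+1};\,q,\,\frac{x^2q}{4}\Big),\qquad x\in\mathbb C. $$ Definition of $P^{(3)}$: put $f:=\max\{|n|,|m-n|\}-1$ and $$ P^{(3)}_{m,n,\nu}(x;q):=\sum_{j=0}^{f}\left(\frac x2\right)^{2j}q^j\Big(A_{m,n,\nu,\,j+\min\{m,0\}}-B_{m,n,\nu,\,j-\max\{m,0\}}\Big) $$ (empty sums are $0$), where $$ A_{m,n,\nu,j}:=\frac{(q^\nu;q)_m(q^{\nu-1};q)_{m-j}}{(q;q)_j}\,q^{(j-m+1)(n-1)+1-n\nu}\;{}_2\phi_1\big(q^{-j},\,q^{\nu+m-j-1};\;q^\nu;\;q,\,q^{j-n+1}\big), $$ $$ B_{m,n,\nu,j}:=\frac{1}{(q;q)_j(q^{2-\nu};q)_j}(-1)^jq^{\binom{j+1}2-j\nu}\;{}_2\phi_1\big(q^{-j},\,q^{\nu-j-1};\;q^{\nu+m};\;q,\,q^{j+n+1}\big). $$ For $j<0$ one has $A_{m,n,\nu,j}=B_{m,n,\nu,j}=0$ (because of the factor $1/(q;q)_j$). *)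

theory Defs
  imports "HOL-Analysis.Analysis" "HOL-Computational_Algebra.Polynomial"
begin

abbreviation qpow :: "real \<Rightarrow> complex \<Rightarrow> complex" where
  "qpow q z \<equiv> complex_of_real q powr z"

text \<open>The shifted factorial \<open>(a;q)\<^sub>k\<close> for \<open>k \<in> \<int>\<close>; for negative indices it is
  \<open>(a;q)\<^sub>-\<^sub>j = 1 / (a q\<^sup>-\<^sup>j; q)\<^sub>j\<close>.\<close>

definition qpoch :: "complex \<Rightarrow> real \<Rightarrow> int \<Rightarrow> complex" where
  "qpoch a q k =
     (if k \<ge> 0 then (\<Prod>i<nat k. 1 - a * of_real q ^ i)
      else 1 / (\<Prod>i<nat (- k). 1 - (a * of_real q powi k) * of_real q ^ i))"

definition qpoch_defined :: "complex \<Rightarrow> real \<Rightarrow> int \<Rightarrow> bool" where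
  "qpoch_defined a q k \<longleftrightarrow> (\<forall>i\<in>{1..- k}. a * of_real q powi (- i) \<noteq> 1)"

definition qpoch_inf :: "complex \<Rightarrow> real \<Rightarrow> complex" where
  "qpoch_inf a q = (\<Prod>i. 1 - a * of_real q ^ i)"

text \<open>Since \<open>(q;q)\<^sub>j\<close> for \<open>j < 0\<close> is a quotient with a vanishing denominator, division by zero
  in HOL gives \<open>(q;q)\<^sub>j = 0\<close>, and hence also the convention \<open>1 / (q;q)\<^sub>j = 0\<close>.\<close>

lemma inverse_qpoch_neg:
  assumes "q \<noteq> 0" "j < 0"
  shows "1 / qpoch (of_real q) q j = 0"
proof -
  obtain k where k: "j = - int (Suc k)"
    using assms by (metis negD)
  have "of_real q * of_real q powi j * of_real q ^ nat (- j - 1) = (1 :: complex)"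
  proof -
    have e: "of_real q powi j = (inverse (of_real q ^ Suc k) :: complex)"
      unfolding k by (simp only: power_int_minus power_int_of_nat)
    have "nat (- j - 1) = k"
      using k by simp
    then show ?thesis
      using assms by (simp add: e field_simps del: inverse_mult_distrib)
  qed
  then have "1 - of_real q * of_real q powi j * of_real q ^ nat (- j - 1) = (0 :: complex)"
    by simp
  moreover have "nat (- j - 1) < nat (- j)"
    using assms by linarith
  ultimately have "(\<Prod>i<nat (- j). 1 - (of_real q * of_real q powi j) * of_real q ^ i)
      = (0 :: complex)"
    by (meson finite_lessThan lessThan_iff prod_zero)
  then show ?thesis
    using assms by (simp add: qpoch_def)
qed

text \<open>The series \<open>\<^sub>r\<phi>\<^sub>s\<close> with upper parameters \<open>al\<close> and lower parameters \<open>bl\<close>.\<close>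

definition qhyp :: "complex list \<Rightarrow> complex list \<Rightarrow> real \<Rightarrow> complex \<Rightarrow> complex" where
  "qhyp al bl q x =
     (\<Sum>j. (\<Prod>a\<leftarrow>al. qpoch a q (int j))
           / (qpoch (of_real q) q (int j) * (\<Prod>b\<leftarrow>bl. qpoch b q (int j)))
         * ((- 1) ^ j * of_real q ^ (j choose 2)) powi (1 + int (length bl) - int (length al))
         * x ^ j)"

definition lower_param_ok :: "real \<Rightarrow> complex \<Rightarrow> bool" where
  "lower_param_ok q b \<longleftrightarrow> (\<forall>k::nat. b \<noteq> of_real q powi (- int k))"

text \<open>Complex powers use the principal branch. HOL has \<open>0 powr 0 = 0\<close>, whereas the leading
  factor of \<open>J\<^sub>0\<close> is \<open>1\<close>, also at the origin.\<close>

definition cpow :: "complex \<Rightarrow> complex \<Rightarrow> complex" where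
  "cpow x \<nu> = (if \<nu> = 0 then 1 else x powr \<nu>)"

definition J3 :: "real \<Rightarrow> complex \<Rightarrow> complex \<Rightarrow> complex" where
  "J3 q \<nu> x =
     qpoch_inf (qpow q (\<nu> + 1)) q / qpoch_inf (of_real q) q * cpow (x / 2) \<nu>
     * qhyp [0] [qpow q (\<nu> + 1)] q (x\<^sup>2 * of_real q / 4)"

definition J3_defined :: "real \<Rightarrow> complex \<Rightarrow> complex \<Rightarrow> bool" where
  "J3_defined q \<nu> x \<longleftrightarrow>
     lower_param_ok q (qpow q (\<nu> + 1)) \<and> (x = 0 \<longrightarrow> \<nu> = 0 \<or> Re \<nu> > 0)"

definition A3 :: "real \<Rightarrow> int \<Rightarrow> int \<Rightarrow> complex \<Rightarrow> int \<Rightarrow> complex" where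
  "A3 q m n \<nu> j =
     qpoch (qpow q \<nu>) q m * qpoch (qpow q (\<nu> - 1)) q (m - j) / qpoch (of_real q) q j
     * qpow q (of_int ((j - m + 1) * (n - 1) + 1) - of_int n * \<nu>)
     * qhyp [of_real q powi (- j), qpow q (\<nu> + of_int (m - j - 1))] [qpow q \<nu>] q
         (of_real q powi (j - n + 1))"

definition B3 :: "real \<Rightarrow> int \<Rightarrow> int \<Rightarrow> complex \<Rightarrow> int \<Rightarrow> complex" where
  "B3 q m n \<nu> j =
     1 / (qpoch (of_real q) q j * qpoch (qpow q (2 - \<nu>)) q j)
     * (- 1) powi j * qpow q (of_int (j * (j + 1)) / 2 - of_int j * \<nu>)
     * qhyp [of_real q powi (- j), qpow q (\<nu> - of_int j - 1)] [qpow q (\<nu> + of_int m)] q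
         (of_real q powi (j + n + 1))"

text \<open>For \<open>j < 0\<close> both coefficients are zero by convention, whatever \<open>\<nu>\<close> is.\<close>

lemma A3_neg: "q \<noteq> 0 \<Longrightarrow> j < 0 \<Longrightarrow> A3 q m n \<nu> j = 0"
  using inverse_qpoch_neg[of q j] by (simp add: A3_def)

lemma B3_neg: "q \<noteq> 0 \<Longrightarrow> j < 0 \<Longrightarrow> B3 q m n \<nu> j = 0"
  using inverse_qpoch_neg[of q j] by (simp add: B3_def)

text \<open>The \<open>_defined\<close> predicates say that no denominator of the formula vanishes and that the
  lower parameters are admissible; they do not exclude integral \<open>\<nu>\<close> as such.\<close>

definition A3_defined :: "real \<Rightarrow> int \<Rightarrow> int \<Rightarrow> complex \<Rightarrow> int \<Rightarrow> bool" where
  "A3_defined q m n \<nu> j \<longleftrightarrow>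
     (j \<ge> 0 \<longrightarrow> qpoch_defined (qpow q \<nu>) q m \<and> qpoch_defined (qpow q (\<nu> - 1)) q (m - j)
        \<and> lower_param_ok q (qpow q \<nu>))"

definition B3_defined :: "real \<Rightarrow> int \<Rightarrow> int \<Rightarrow> complex \<Rightarrow> int \<Rightarrow> bool" where
  "B3_defined q m n \<nu> j \<longleftrightarrow>
     (j \<ge> 0 \<longrightarrow> qpoch (qpow q (2 - \<nu>)) q j \<noteq> 0 \<and> lower_param_ok q (qpow q (\<nu> + of_int m)))"

definition P3_deg :: "int \<Rightarrow> int \<Rightarrow> int" where
  "P3_deg m n = max \<bar>n\<bar> \<bar>m - n\<bar> - 1"

definition P3 :: "real \<Rightarrow> int \<Rightarrow> int \<Rightarrow> complex \<Rightarrow> complex \<Rightarrow> complex" where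
  "P3 q m n \<nu> x =
     (\<Sum>j\<in>{0..P3_deg m n}. (x / 2) ^ (2 * nat j) * of_real q ^ nat j
        * (A3 q m n \<nu> (j + min m 0) - B3 q m n \<nu> (j - max m 0)))"

definition P3_defined :: "real \<Rightarrow> int \<Rightarrow> int \<Rightarrow> complex \<Rightarrow> bool" where
  "P3_defined q m n \<nu> \<longleftrightarrow>
     (\<forall>j\<in>{0..P3_deg m n}. A3_defined q m n \<nu> (j + min m 0) \<and> B3_defined q m n \<nu> (j - max m 0))"

definition R3 :: "real \<Rightarrow> int \<Rightarrow> int \<Rightarrow> complex \<Rightarrow> complex \<Rightarrow> complex" where
  "R3 q m n \<nu> x =
     qpoch_inf (qpow q (\<nu> + of_int m + 1)) q / qpoch_inf (qpow q (\<nu> - 1)) q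
     * of_real q powi (- max (m + 1) 0) * (x / 2) powi (min (m + 2) (- m)) * P3 q (m + 1) n \<nu> x"

definition R3_defined :: "real \<Rightarrow> int \<Rightarrow> int \<Rightarrow> complex \<Rightarrow> complex \<Rightarrow> bool" where
  "R3_defined q m n \<nu> x \<longleftrightarrow>
     qpoch_inf (qpow q (\<nu> - 1)) q \<noteq> 0 \<and> (x = 0 \<longrightarrow> min (m + 2) (- m) \<ge> 0)
     \<and> P3_defined q (m + 1) n \<nu>"

end

theory Submission
  imports Defs "HOL-Computational_Algebra.Formal_Laurent_Series"
begin

text \<open>
  Put \<open>v = q\<^bsup>\<nu>-1\<^esup>\<close> and \<open>y = q (x/2)\<^sup>2\<close>. Stripped of their leading powers, the functions
  \<open>J\<^bsub>\<nu>+m-1\<^esub>(x q\<^bsup>n/2\<^esup>)\<close> form an array \<open>G m n\<close> on the lattice \<open>\<int> \<times> \<int>\<close>, and two elementary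
  contiguous relations, one shifting \<open>\<nu>\<close> and one shifting \<open>x\<close>, say that three vertices of a unit
  square are linearly dependent (\<open>contiguous\<close>). The solution space of this system is two-dimensional:
  the values at \<open>(1,0)\<close> and \<open>(0,0)\<close> determine all others, with coefficients continuous in
  \<open>v \<noteq> 0\<close> (\<open>fundamental_exists\<close>). The three-term relation is this statement for the Bessel array,
  and what has to be shown is that the coefficients are the explicit \<open>R\<close>.

  The coefficients are themselves the solutions of the system with initial values \<open>1, 0\<close> and
  \<open>0, 1\<close>. For \<open>v\<close> that is no integral power of \<open>q\<close> the system has a second solution beside the
  Bessel array, a Laurent series in \<open>y\<close>. The Casoratian of the two solutions at \<open>(m,n)\<close>
  and \<open>(0,0)\<close> solves the system, vanishes at \<open>(0,0)\<close>, and equals \<open>q / y\<close> at \<open>(1,0)\<close>. Its two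
  products have the terminating series \<open>A\<close> and \<open>B\<close> as coefficients (\<open>A3_eq_coeff\<close>,
  \<open>B3_eq_coeff\<close>), which explains the difference \<open>A - B\<close> in the definition of \<open>P\<close>. As a product of
  infinite series it is at first an infinite series as well; but the recursion, started from \<open>0\<close>
  and \<open>q / y\<close>, only produces Laurent polynomials, and following the degrees over growing squares
  of the lattice gives the range of summation in \<open>P\<close> (\<open>contiguous_coeff_vanish\<close>).

  If \<open>v\<close> is an integral power of \<open>q\<close>, the second solution need not exist although \<open>P\<close> does.
  There the fundamental coefficients and \<open>P\<close> are both continuous in \<open>\<nu>\<close>, so the identity between
  them is inherited from neighbouring parameters (\<open>nonresonant_limit\<close>).
\<close>

section \<open>The contiguity system on the lattice\<close>

text \<open>The model solution is \<open>G m n = \<Phi>(v q\<^sup>m, q\<^sup>n z)\<close> with \<open>y = q z\<close>, where \<open>\<Phi>(q\<^sup>\<nu>, (x/2)\<^sup>2)\<close> is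
  \<open>J\<^sub>\<nu>(x)\<close> without its power of \<open>x/2\<close> and without the factor \<open>1/(q;q)\<^sub>\<infinity>\<close>.\<close>

definition contiguous :: "complex \<Rightarrow> complex \<Rightarrow> complex \<Rightarrow> (int \<Rightarrow> int \<Rightarrow> complex) \<Rightarrow> bool" where
  "contiguous Q v y G \<longleftrightarrow>
     (\<forall>m n. G m n = G (m + 1) n - v * Q powi (m + 1) * G (m + 1) (n + 1)) \<and>
     (\<forall>m n. G m n = G m (n + 1) - Q powi n * y * G (m + 1) (n + 1))"

text \<open>Each relation of the system links three vertices of a unit square, so a property passes from two
  vertices of such a triple to the third. Horizontally adjacent pairs of vertices can then be
  moved by one step in each of the four directions.\<close>

lemma lattice_induct:
  fixes Pr :: "int \<Rightarrow> int \<Rightarrow> bool"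
  assumes base: "Pr 0 0" "Pr 1 0"
    and a1: "\<And>m n. Pr m n \<Longrightarrow> Pr (m + 1) n \<Longrightarrow> Pr (m + 1) (n + 1)"
    and a2: "\<And>m n. Pr m n \<Longrightarrow> Pr (m + 1) (n + 1) \<Longrightarrow> Pr (m + 1) n"
    and a3: "\<And>m n. Pr (m + 1) n \<Longrightarrow> Pr (m + 1) (n + 1) \<Longrightarrow> Pr m n"
    and b1: "\<And>m n. Pr m n \<Longrightarrow> Pr m (n + 1) \<Longrightarrow> Pr (m + 1) (n + 1)"
    and b2: "\<And>m n. Pr m n \<Longrightarrow> Pr (m + 1) (n + 1) \<Longrightarrow> Pr m (n + 1)"
    and b3: "\<And>m n. Pr m (n + 1) \<Longrightarrow> Pr (m + 1) (n + 1) \<Longrightarrow> Pr m n"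
  shows "Pr m n"
proof -
  define E where "E m n \<longleftrightarrow> Pr m n \<and> Pr (m + 1) n" for m n
  have up: "E m (n + 1)" if "E m n" for m n
    using that a1 b2 unfolding E_def by blast
  have down: "E m n" if "E m (n + 1)" for m n
    using that a2 b3 unfolding E_def by blast
  have right: "E (m + 1) n" if e: "E m n" for m n
  proof -
    have "Pr (m + 1) (n + 1)" "Pr (m + 1) n"
      using e a1 unfolding E_def by blast+
    then have "Pr (m + 1 + 1) (n + 1)" by (rule b1[rotated])
    with \<open>Pr (m + 1) n\<close> show ?thesis unfolding E_def using a2 by blast
  qed
  have left: "E m n" if e: "E (m + 1) n" for m n
  proof -
    have "E (m + 1) (n + 1)" by (rule up[OF e])
    with e show ?thesis unfolding E_def using a3 by blast
  qed
  have 1: "E 0 n" for n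
  proof (induction n rule: int_induct[where k = 0])
    case base then show ?case using assms(1,2) by (simp add: E_def)
  next
    case (step1 i) then show ?case using up by blast
  next
    case (step2 i) then show ?case using down[of 0 "i - 1"] by simp
  qed
  have "E m n"
  proof (induction m rule: int_induct[where k = 0])
    case base then show ?case by (rule 1)
  next
    case (step1 i) then show ?case using right by blast
  next
    case (step2 i) then show ?case using left[of "i - 1"] by simp
  qed
  then show ?thesis by (simp add: E_def)
qed

text \<open>\<open>\<alpha>\<close> and \<open>\<beta>\<close> are the values at \<open>(m,n)\<close> of the solutions with initial values \<open>1, 0\<close> and \<open>0, 1\<close>
  at \<open>(1,0)\<close>, \<open>(0,0)\<close>, as functions of the parameter. Continuity is what allows passing to
  parameters for which no second explicit solution is available.\<close>

definition fundamental ::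
    "complex \<Rightarrow> complex \<Rightarrow> int \<Rightarrow> int \<Rightarrow> (complex \<Rightarrow> complex) \<Rightarrow> (complex \<Rightarrow> complex) \<Rightarrow> bool" where
  "fundamental Q y m n \<alpha> \<beta> \<longleftrightarrow> continuous_on (- {0}) \<alpha> \<and> continuous_on (- {0}) \<beta> \<and>
     (\<forall>v G. v \<noteq> 0 \<longrightarrow> contiguous Q v y G \<longrightarrow> G m n = \<alpha> v * G 1 0 + \<beta> v * G 0 0)"

text \<open>Solving a relation of the system for any one of its three terms divides only by \<open>v Q\<^sup>k\<close> or by
  \<open>y Q\<^sup>k\<close>, so no parameter \<open>v \<noteq> 0\<close> is exceptional.\<close>

lemma fundamental_exists:
  assumes Q: "Q \<noteq> 0" and y: "y \<noteq> 0"
  shows "\<exists>\<alpha> \<beta>. fundamental Q y m n \<alpha> \<beta>"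
proof -
  define good where "good m n \<longleftrightarrow> (\<exists>\<alpha> \<beta>. fundamental Q y m n \<alpha> \<beta>)" for m n
  have comb: "good m n"
    if g1: "good m1 n1" and g2: "good m2 n2"
      and f: "continuous_on (- {0}) f" and g: "continuous_on (- {0}) g"
      and eq: "\<And>v G. v \<noteq> 0 \<Longrightarrow> contiguous Q v y G \<Longrightarrow> G m n = f v * G m1 n1 + g v * G m2 n2"
    for m n m1 n1 m2 n2 f g
  proof -
    from g1 obtain a1 b1 where 1: "continuous_on (- {0}) a1" "continuous_on (- {0}) b1"
      "\<And>v G. v \<noteq> 0 \<Longrightarrow> contiguous Q v y G \<Longrightarrow> G m1 n1 = a1 v * G 1 0 + b1 v * G 0 0"
      unfolding good_def fundamental_def by blast
    from g2 obtain a2 b2 where 2: "continuous_on (- {0}) a2" "continuous_on (- {0}) b2"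
      "\<And>v G. v \<noteq> 0 \<Longrightarrow> contiguous Q v y G \<Longrightarrow> G m2 n2 = a2 v * G 1 0 + b2 v * G 0 0"
      unfolding good_def fundamental_def by blast
    show ?thesis unfolding good_def fundamental_def
    proof (intro exI conjI allI impI)
      show "continuous_on (- {0}) (\<lambda>v. f v * a1 v + g v * a2 v)"
        "continuous_on (- {0}) (\<lambda>v. f v * b1 v + g v * b2 v)"
        by (intro continuous_intros 1 2 f g)+
      fix v G assume "v \<noteq> 0" "contiguous Q v y G"
      from eq[OF this] 1(3)[OF this] 2(3)[OF this]
      show "G m n = (f v * a1 v + g v * a2 v) * G 1 0 + (f v * b1 v + g v * b2 v) * G 0 0"
        by (simp add: algebra_simps)
    qed
  qed
  have ca: "G m n = G (m + 1) n - v * Q powi (m + 1) * G (m + 1) (n + 1)"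
    and cb: "G m n = G m (n + 1) - Q powi n * y * G (m + 1) (n + 1)"
    if "contiguous Q v y G" for v G m n
    using that unfolding contiguous_def by blast+
  have "good m n"
  proof (rule lattice_induct[where Pr = good])
    show "good 0 0" unfolding good_def fundamental_def
      by (intro exI[of _ "\<lambda>_. 0"] exI[of _ "\<lambda>_. 1"]) auto
    show "good 1 0" unfolding good_def fundamental_def
      by (intro exI[of _ "\<lambda>_. 0"] exI[of _ "\<lambda>_. 1"]) auto
  next
    fix m n assume h: "good m n" "good (m + 1) n"
    show "good (m + 1) (n + 1)"
    proof (rule comb[OF h, of "\<lambda>v. - 1 / (v * Q powi (m + 1))" "\<lambda>v. 1 / (v * Q powi (m + 1))"])
      fix v G assume "v \<noteq> 0" and G: "contiguous Q v y G"
      then show "G (m + 1) (n + 1) =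
        - 1 / (v * Q powi (m + 1)) * G m n + 1 / (v * Q powi (m + 1)) * G (m + 1) n"
        using Q ca[OF G, of m n] by (simp add: field_simps)
    qed (use Q in \<open>auto intro!: continuous_intros\<close>)
  next
    fix m n assume h: "good m n" "good (m + 1) (n + 1)"
    show "good (m + 1) n"
    proof (rule comb[OF h, of "\<lambda>v. 1" "\<lambda>v. v * Q powi (m + 1)"], goal_cases)
      case (3 v G)
      then show ?case using ca[of v G m n] by simp
    qed (intro continuous_intros)+
    show "good m (n + 1)"
    proof (rule comb[OF h, of "\<lambda>v. 1" "\<lambda>v. Q powi n * y"], goal_cases)
      case (3 v G)
      then show ?case using cb[of v G m n] by simp
    qed (intro continuous_intros)+
  next
    fix m n assume h: "good (m + 1) n" "good (m + 1) (n + 1)"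
    show "good m n"
    proof (rule comb[OF h, of "\<lambda>v. 1" "\<lambda>v. - v * Q powi (m + 1)"], goal_cases)
      case (3 v G)
      then show ?case using ca[of v G m n] by simp
    qed (intro continuous_intros)+
  next
    fix m n assume h: "good m n" "good m (n + 1)"
    show "good (m + 1) (n + 1)"
    proof (rule comb[OF h, of "\<lambda>v. - 1 / (Q powi n * y)" "\<lambda>v. 1 / (Q powi n * y)"])
      fix v G assume G: "contiguous Q v y G"
      show "G (m + 1) (n + 1) = - 1 / (Q powi n * y) * G m n + 1 / (Q powi n * y) * G m (n + 1)"
        using Q y cb[OF G, of m n] by (simp add: field_simps)
    qed auto
  next
    fix m n assume h: "good m (n + 1)" "good (m + 1) (n + 1)"
    show "good m n"
    proof (rule comb[OF h, of "\<lambda>v. 1" "\<lambda>v. - (Q powi n * y)"], goal_cases)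
      case (3 v G)
      then show ?case using cb[of v G m n] by simp
    qed (intro continuous_intros)+
  qed
  then show ?thesis unfolding good_def .
qed

text \<open>The degree bound behind \<open>max {|n|, |m - n|} - 1\<close>. After multiplication by \<open>y\<^bsup>max m 0\<^esup>\<close> a
  solution with these initial values has degree less than \<open>N\<close> on the square
  \<open>|n| \<le> N\<close>, \<open>|m - n| \<le> N\<close>. The coordinates \<open>n\<close> and \<open>n - m\<close> are the natural ones, since in
  them the two triples of vertices are the two halves of a unit square; enlarging the square by one
  raises the degree by at most one. The induction starts at \<open>N = 1\<close>: the square with \<open>N = 0\<close>
  contains only one of the two initial points.\<close>

lemma contiguous_coeff_vanish:
  fixes c :: "int \<Rightarrow> int \<Rightarrow> int \<Rightarrow> complex"
  assumes Q: "Q \<noteq> 0" and v: "v \<noteq> 0"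
    and a: "\<And>m n k. c m n k = c (m + 1) n k - v * Q powi (m + 1) * c (m + 1) (n + 1) k"
    and b: "\<And>m n k. c m n k = c m (n + 1) k - Q powi n * c (m + 1) (n + 1) (k - 1)"
    and c00: "\<And>k. c 0 0 k = 0" and c10: "\<And>k. k \<ge> 0 \<Longrightarrow> c 1 0 k = 0"
    and k: "k + max m 0 \<ge> max \<bar>n\<bar> \<bar>m - n\<bar>"
  shows "c m n k = 0"
proof -
  have a1: "c (m + 1) (n + 1) k = 0" if "c m n k = 0" "c (m + 1) n k = 0" for m n k
    using a[of m n k] that Q v by simp
  have a2: "c (m + 1) n k = 0" if "c m n k = 0" "c (m + 1) (n + 1) k = 0" for m n k
    using a[of m n k] that by simp
  have a3: "c m n k = 0" if "c (m + 1) n k = 0" "c (m + 1) (n + 1) k = 0" for m n k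
    using a[of m n k] that by simp
  have b1: "c (m + 1) (n + 1) k = 0" if "c m n (k + 1) = 0" "c m (n + 1) (k + 1) = 0" for m n k
    using b[of m n "k + 1"] that Q by simp
  have b2: "c m (n + 1) k = 0" if "c m n k = 0" "c (m + 1) (n + 1) (k - 1) = 0" for m n k
    using b[of m n k] that by simp
  have b3: "c m n k = 0" if "c m (n + 1) k = 0" "c (m + 1) (n + 1) (k - 1) = 0" for m n k
    using b[of m n k] that by simp
  have square: "\<forall>m n k. \<bar>n\<bar> \<le> int N \<longrightarrow> \<bar>m - n\<bar> \<le> int N \<longrightarrow> k + max m 0 \<ge> int N \<longrightarrow> c m n k = 0"
    if "N \<ge> 1" for N
    using that
  proof (induction N rule: dec_induct)
    case base
    have c11: "c 1 1 k = 0" if "k \<ge> 0" for k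
      using a1[of 0 0 k] c00 c10[OF that] by simp
    have c01: "c 0 1 k = 0" if "k \<ge> 1" for k
      using b2[of 0 0 k] c00 c11[of "k - 1"] that by simp
    have c21: "c 2 1 k = 0" if "k \<ge> - 1" for k
      using b1[of 1 0 k] c11[of "k + 1"] c10[of "k + 1"] that by simp
    have cm10: "c (- 1) 0 k = 0" if "k \<ge> 1" for k
      using a3[of "- 1" 0 k] c00 c01[OF that] by simp
    have c0m1: "c 0 (- 1) k = 0" if "k \<ge> 1" for k
      using b3[of 0 "- 1" k] c00 c10[of "k - 1"] that by simp
    have cm1m1: "c (- 1) (- 1) k = 0" if "k \<ge> 1" for k
      using a3[of "- 1" "- 1" k] c00 c0m1[OF that] by simp
    have cm2m1: "c (- 2) (- 1) k = 0" if "k \<ge> 1" for k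
      using a3[of "- 2" "- 1" k] cm10 cm1m1 that by simp
    show ?case
    proof (intro allI impI)
      fix m n k :: int
      assume h: "\<bar>n\<bar> \<le> int 1" "\<bar>m - n\<bar> \<le> int 1" "k + max m 0 \<ge> int 1"
      have "n = - 1 \<or> n = 0 \<or> n = 1" "m - n = - 1 \<or> m - n = 0 \<or> m - n = 1"
        using h by (simp_all add: abs_le_iff) presburger+
      then obtain b where m: "m = n + b" and "n = - 1 \<or> n = 0 \<or> n = 1" "b = - 1 \<or> b = 0 \<or> b = 1"
        by (metis add.commute diff_add_cancel)
      from this(2,3) show "c m n k = 0" using h(3) unfolding m
        by (elim disjE)
           (simp_all add: c00 c10[of k] c11[of k] c01[of k] c21[of k] cm10[of k] c0m1[of k]
            cm1m1[of k] cm2m1[of k])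
    qed
  next
    case (step N)
    define M where "M = int N"
    have M: "M \<ge> 1" using step M_def by simp
    have IH: "c m n k = 0" if "\<bar>n\<bar> \<le> M" "\<bar>m - n\<bar> \<le> M" "k + max m 0 \<ge> M" for m n k
      using step.IH that unfolding M_def by blast
    \<comment> \<open>The half \<open>m \<ge> 0\<close>: the sides \<open>n = M + 1\<close> and \<open>m - n = - M - 1\<close>, each walked towards a corner.\<close>
    have s1: "c m (M + 1) k = 0" if "1 \<le> m" "m \<le> 2 * M" "k + m \<ge> M + 1" for m k
      using a1[of "m - 1" M k] IH[of M "m - 1" k] IH[of M m k] that by simp
    have s2: "c (2 * M + 1) (M + 1) k = 0" if "k + 2 * M + 1 \<ge> M + 1" for k
      using b1[of "2 * M" M k] IH[of M "2 * M" "k + 1"] s1[of "2 * M" "k + 1"] that M by simp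
    have s3: "c 0 (M + 1) k = 0" if "k \<ge> M + 1" for k
      using b2[of 0 M k] IH[of M 0 k] s1[of 1 "k - 1"] that M by simp
    have s4: "c m (m - M - 1) k = 0" if "1 \<le> m" "m \<le> 2 * M" "k + m \<ge> M + 1" for m k
      using a2[of "m - 1" "m - M - 1" k] IH[of "m - M - 1" "m - 1" k] IH[of "m - M" m k] that by simp
    have s5: "c (2 * M + 1) M k = 0" if "k + 2 * M + 1 \<ge> M + 1" for k
      using a2[of "2 * M" M k] IH[of M "2 * M" k] s2[of k] that M by simp
    have s6: "c (2 * M + 2) (M + 1) k = 0" if "k + 2 * M + 2 \<ge> M + 1" for k
      using b1[of "2 * M + 1" M k] s5[of "k + 1"] s2[of "k + 1"] that M by (simp add: add.commute)
    have s7: "c 0 (- M - 1) k = 0" if "k \<ge> M + 1" for k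
      using b3[of 0 "- M - 1" k] IH[of "- M" 0 k] s4[of 1 "k - 1"] that M by simp
    \<comment> \<open>The half \<open>m < 0\<close>: the sides \<open>m - n = M + 1\<close> and \<open>n = - M - 1\<close>.\<close>
    have t1: "c m (m + M + 1) k = 0" if "- 2 * M \<le> m" "m \<le> - 1" "k \<ge> M + 1" for m k
      using b2[of m "m + M" k] IH[of "m + M" m k] IH[of "m + M + 1" "m + 1" "k - 1"] that by simp
    have t2: "c (- 2 * M - 1) (- M) k = 0" if "k \<ge> M + 1" for k
      using a3[of "- 2 * M - 1" "- M" k] IH[of "- M" "- 2 * M" k] t1[of "- 2 * M" k] that M by simp
    have t3: "c m (- M - 1) k = 0" if "- 2 * M \<le> m" "m \<le> - 1" "k \<ge> M + 1" for m k
      using b3[of m "- M - 1" k] IH[of "- M" m k] IH[of "- M" "m + 1" "k - 1"] that by simp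
    have t4: "c (- 2 * M - 1) (- M - 1) k = 0" if "k \<ge> M + 1" for k
      using b3[of "- 2 * M - 1" "- M - 1" k] t2[of k] IH[of "- M" "- 2 * M" "k - 1"] that M by simp
    have t5: "c (- 2 * M - 2) (- M - 1) k = 0" if "k \<ge> M + 1" for k
    proof -
      have "- 2 * M - 2 + 1 = - 2 * M - 1" "- M - 1 + 1 = - M" by simp_all
      then show ?thesis
        using a3[of "- 2 * M - 2" "- M - 1" k] t4[OF that] t2[OF that] by metis
    qed
    show ?case
    proof (intro allI impI)
      fix m n k
      assume h: "\<bar>n\<bar> \<le> int (Suc N)" "\<bar>m - n\<bar> \<le> int (Suc N)" "k + max m 0 \<ge> int (Suc N)"
      then have h': "\<bar>n\<bar> \<le> M + 1" "\<bar>m - n\<bar> \<le> M + 1" "k + max m 0 \<ge> M + 1"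
        by (auto simp: M_def)
      consider "\<bar>n\<bar> \<le> M" "\<bar>m - n\<bar> \<le> M" | "n = M + 1" "0 \<le> m" "m \<le> 2 * M + 2"
        | "n = - M - 1" "m \<le> 0" "m \<ge> - 2 * M - 2"
        | "m - n = M + 1" "n \<noteq> M + 1" "n \<noteq> - M - 1" | "m - n = - M - 1" "n \<noteq> - M - 1" "n \<noteq> M + 1"
        using h' by linarith
      then show "c m n k = 0"
      proof cases
        case 1 then show ?thesis using IH h' by simp
      next
        case 2
        then consider "m = 0" | "1 \<le> m" "m \<le> 2 * M" | "m = 2 * M + 1" | "m = 2 * M + 2" by linarith
        then show ?thesis by cases (use 2 s1 s2 s3 s6 h' M in auto)
      next
        case 3
        then consider "m = 0" | "- 2 * M \<le> m" "m \<le> - 1" | "m = - 2 * M - 1" | "m = - 2 * M - 2" by linarith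
        then show ?thesis by cases (use 3 s7 t3 t4 t5 h' M in auto)
      next
        case 4
        then consider "1 \<le> m" "m \<le> 2 * M" | "m = 2 * M + 1" using h' by linarith
        then show ?thesis
          by cases (use 4 s4[of m k] s5[of k] h' M in \<open>auto simp: algebra_simps\<close>)
      next
        case 5
        then have n: "n = m + M + 1" by simp
        consider "- 2 * M \<le> m" "m \<le> - 1" | "m = - 2 * M - 1" using 5 h' by linarith
        then show ?thesis
        proof cases
          case 1 then show ?thesis unfolding n using t1[of m k] h' by simp
        next
          case 2
          then have "n = - M" using n by simp
          moreover have "k \<ge> M + 1" using h' 2 M by simp
          ultimately show ?thesis using t2[of k] 2 by simp
        qed
      qed
    qed
  qed
  show ?thesis
  proof (cases "max \<bar>n\<bar> \<bar>m - n\<bar> = 0")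
    case True
    then have "n = 0" "m = 0" by linarith+
    then show ?thesis using c00 by simp
  next
    case False
    define N where "N = nat (max \<bar>n\<bar> \<bar>m - n\<bar>)"
    have N: "N \<ge> 1" "int N = max \<bar>n\<bar> \<bar>m - n\<bar>" using False by (simp_all add: N_def)
    from square[OF N(1)] show ?thesis using k unfolding N(2) by simp
  qed
qed

section \<open>Shifted factorials with integer index\<close>

lemma qpoch_0 [simp]: "qpoch a q 0 = 1"
  by (simp add: qpoch_def)

text \<open>For a negative index the factor removed from the denominator must not vanish; otherwise the
  quotient is \<open>0\<close> by convention and the recursion breaks down.\<close>

lemma qpoch_plus_1:
  assumes q: "q \<noteq> 0" and neg: "k < 0 \<Longrightarrow> a * of_real q powi k \<noteq> 1"
  shows "qpoch a q (k + 1) = qpoch a q k * (1 - a * of_real q powi k)"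
proof (cases "k \<ge> 0")
  case True
  then obtain n where "k = int n" by (metis nonneg_int_cases)
  then show ?thesis by (simp add: qpoch_def nat_add_distrib)
next
  case False
  then obtain n where n: "k = - int n - 1"
    by (intro that[of "nat (- k - 1)"]) auto
  have shift: "a * of_real q powi (- int n - 1) * of_real q ^ Suc i = a * of_real q powi (- int n) * of_real q ^ i" for i
    using q by (simp add: power_int_diff)
  have "nat (- k) = Suc n" using n by simp
  then have k: "qpoch a q k = 1 / ((1 - a * of_real q powi k) *
      (\<Prod>i<n. 1 - a * of_real q powi (- int n) * of_real q ^ i))"
    using False by (simp only: qpoch_def prod.lessThan_Suc_shift)
      (simp add: n shift flip: power_Suc)
  have k1: "qpoch a q (k + 1) = 1 / (\<Prod>i<n. 1 - a * of_real q powi (- int n) * of_real q ^ i)"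
    by (cases "n = 0") (auto simp: n qpoch_def)
  show ?thesis using neg False unfolding k k1 by simp
qed

lemma qpoch_add_nat:
  assumes q: "q \<noteq> 0" and neg: "\<And>l. l < 0 \<Longrightarrow> a * of_real q powi l \<noteq> 1"
  shows "qpoch a q (k + int n) = qpoch a q k * qpoch (a * of_real q powi k) q (int n)"
proof (induction n)
  case (Suc n)
  have "qpoch a q (k + int (Suc n)) = qpoch a q (k + int n) * (1 - a * of_real q powi (k + int n))"
    using qpoch_plus_1[OF q neg, of "k + int n"] by (simp add: add_ac)
  moreover have "qpoch (a * of_real q powi k) q (int (Suc n))
      = qpoch (a * of_real q powi k) q (int n) * (1 - a * of_real q powi (k + int n))"
    using qpoch_plus_1[OF q, of "int n" "a * of_real q powi k"] q
    by (simp add: add_ac power_int_add)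
  ultimately show ?case using Suc by simp
qed auto

text \<open>For these parameters every \<open>(v;q)\<^sub>k\<close> with \<open>k \<in> \<int>\<close> is finite and nonzero, so that both
  solutions of the contiguity system can be written down.\<close>

definition nonresonant :: "real \<Rightarrow> complex \<Rightarrow> bool" where
  "nonresonant q v \<longleftrightarrow> v \<noteq> 0 \<and> (\<forall>k. v * of_real q powi k \<noteq> 1)"

lemma nonresonant_mult_power:
  assumes "nonresonant q v" "q \<noteq> 0"
  shows "nonresonant q (v * of_real q powi k)"
  using assms by (auto simp: nonresonant_def mult.assoc simp flip: power_int_add)

lemma qpoch_nonresonant_plus_1:
  "nonresonant q v \<Longrightarrow> q \<noteq> 0 \<Longrightarrow> qpoch v q (k + 1) = qpoch v q k * (1 - v * of_real q powi k)"
  by (rule qpoch_plus_1) (auto simp: nonresonant_def)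

lemma qpoch_nonresonant_nonzero:
  assumes "nonresonant q v" "q \<noteq> 0"
  shows "qpoch v q k \<noteq> 0"
proof (induction k rule: int_induct[where k = 0])
  case (step1 i)
  then show ?case using qpoch_nonresonant_plus_1[OF assms, of i] assms by (simp add: nonresonant_def)
next
  case (step2 i)
  then show ?case using qpoch_nonresonant_plus_1[OF assms, of "i - 1"] by auto
qed auto

text \<open>The reciprocal is the convenient object: it is \<open>0\<close> at negative indices and satisfies its
  recursion at all integers, so sums over its support need no boundary terms.\<close>

definition qfact_inv :: "real \<Rightarrow> int \<Rightarrow> complex" where
  "qfact_inv q k = 1 / qpoch (of_real q) q k"

lemma qfact_inv_0 [simp]: "qfact_inv q 0 = 1"
  by (simp add: qfact_inv_def)

lemma qfact_inv_neg: "q \<noteq> 0 \<Longrightarrow> k < 0 \<Longrightarrow> qfact_inv q k = 0"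
  unfolding qfact_inv_def by (rule inverse_qpoch_neg)

lemma powi_q_neq_1:
  assumes "0 < q" "q < 1" "k > 0"
  shows "complex_of_real q powi k \<noteq> 1"
proof
  assume "complex_of_real q powi k = 1"
  then have "complex_of_real (q ^ nat k) = 1" using assms by (simp add: power_int_def)
  then have "q ^ nat k = 1" using of_real_eq_1_iff by blast
  moreover have "q ^ nat k < 1" using assms by (simp add: power_less_one_iff)
  ultimately show False by simp
qed

lemma qfact_inv_step:
  assumes q: "0 < q" "q < 1"
  shows "qfact_inv q k = (1 - of_real q powi (k + 1)) * qfact_inv q (k + 1)"
proof -
  consider "k < - 1" | "k = - 1" | "k \<ge> 0" by linarith
  then show ?thesis
  proof cases
    case 1 then show ?thesis using q by (simp add: qfact_inv_neg)
  next
    case 2 then show ?thesis using q by (simp add: qfact_inv_neg)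
  next
    case 3
    have "qpoch (of_real q) q (k + 1) = qpoch (of_real q) q k * (1 - of_real q powi (k + 1))"
      using qpoch_plus_1[of q k "of_real q"] 3 q by (simp add: power_int_add mult.commute)
    moreover have "of_real q powi (k + 1) \<noteq> (1 :: complex)"
      using powi_q_neq_1[OF q] 3 by simp
    ultimately show ?thesis by (simp add: qfact_inv_def)
  qed
qed

text \<open>The binomial coefficient \<open>i\<close> over \<open>2\<close>, extended to all integers as a polynomial.\<close>

definition tri :: "int \<Rightarrow> int" where "tri i = i * (i - 1) div 2"

lemma tri_0 [simp]: "tri 0 = 0"
  by (simp add: tri_def)

lemma tri_plus_1: "tri (i + 1) = tri i + i"
proof -
  have "(i + 1) * (i + 1 - 1) = i * (i - 1) + i * 2" by (simp add: algebra_simps)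
  then show ?thesis unfolding tri_def by (metis div_mult_self1 zero_neq_numeral add.commute)
qed

section \<open>Two formal solutions and their Casoratian\<close>

text \<open>The coefficient of \<open>y\<^sup>i\<close> in the Bessel array divided by \<open>(v;q)\<^sub>\<infinity>\<close>; dividing turns the
  infinite product \<open>(v q\<^bsup>m+i+1\<^esup>;q)\<^sub>\<infinity>\<close> into \<open>1/(v;q)\<^bsub>m+i+1\<^esub>\<close>.\<close>

definition regular_coeff :: "real \<Rightarrow> complex \<Rightarrow> int \<Rightarrow> int \<Rightarrow> int \<Rightarrow> complex" where
  "regular_coeff q v m n i = (- 1) powi i * of_real q powi (tri i + n * i) * qfact_inv q i / qpoch v q (m + i + 1)"

text \<open>The coefficients of a second solution, a Laurent series in \<open>y\<close> with lowest term \<open>y\<^bsup>-m\<^esup>\<close>. The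
  form is found by reading \<open>A\<close> and \<open>B\<close> as Cauchy products in which \<open>regular_coeff\<close> is one factor.\<close>

definition second_coeff :: "real \<Rightarrow> complex \<Rightarrow> int \<Rightarrow> int \<Rightarrow> int \<Rightarrow> complex" where
  "second_coeff q v m n p = qpoch v q (- p) * qfact_inv q (p + m) * of_real q powi ((n - 1) * p) * v powi (- n)"

context
  fixes q :: real and v :: complex
  assumes q: "0 < q" "q < 1" and v: "nonresonant q v"
begin

lemma q_nonzero: "complex_of_real q \<noteq> 0" "q \<noteq> 0" and v_nonzero: "v \<noteq> 0"
  using q v by (auto simp: nonresonant_def)

lemma powi_mult:
  "a + b = c \<Longrightarrow> complex_of_real q powi a * of_real q powi b = of_real q powi c"
  using q_nonzero by (metis power_int_add)

lemma regular_coeff_parameter: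
  "regular_coeff q v m n i
    = regular_coeff q v (m + 1) n i - v * of_real q powi (m + 1) * regular_coeff q v (m + 1) (n + 1) i"
proof -
  have "qpoch v q (m + i + 2) = qpoch v q (m + i + 1) * (1 - v * of_real q powi (m + i + 1))"
    using qpoch_nonresonant_plus_1[OF v q_nonzero(2), of "m + i + 1"] by (simp add: add_ac)
  then have 1: "1 / qpoch v q (m + i + 1) = (1 - v * of_real q powi (m + i + 1)) / qpoch v q (m + i + 2)"
    using qpoch_nonresonant_nonzero[OF v q_nonzero(2)] by (simp add: field_simps)
  have 2: "complex_of_real q powi (m + i + 1) * of_real q powi (tri i + n * i)
      = of_real q powi (m + 1) * of_real q powi (tri i + (n + 1) * i)"
    using q_nonzero by (simp add: algebra_simps flip: power_int_add)
  have "regular_coeff q v m n i = (- 1) powi i * of_real q powi (tri i + n * i) * qfact_inv q i * (1 / qpoch v q (m + i + 1))"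
    by (simp add: regular_coeff_def)
  also have "\<dots> = regular_coeff q v (m + 1) n i - v * (of_real q powi (m + i + 1) * of_real q powi (tri i + n * i))
       * (- 1) powi i * qfact_inv q i / qpoch v q (m + i + 2)"
    unfolding 1 by (simp add: regular_coeff_def diff_divide_distrib algebra_simps)
  also have "\<dots> = regular_coeff q v (m + 1) n i - v * of_real q powi (m + 1) * regular_coeff q v (m + 1) (n + 1) i"
    unfolding 2 by (simp add: regular_coeff_def algebra_simps)
  finally show ?thesis .
qed

lemma regular_coeff_argument:
  "regular_coeff q v m n i
    = regular_coeff q v m (n + 1) i - of_real q powi n * regular_coeff q v (m + 1) (n + 1) (i - 1)"
proof -
  have t: "tri i = tri (i - 1) + (i - 1)" using tri_plus_1[of "i - 1"] by simp
  have 1: "qfact_inv q (i - 1) = (1 - of_real q powi i) * qfact_inv q i"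
    using qfact_inv_step[OF q, of "i - 1"] by simp
  have 2: "complex_of_real q powi n * of_real q powi (tri (i - 1) + (n + 1) * (i - 1))
      = of_real q powi (tri i + n * i)"
    by (rule powi_mult) (simp add: t algebra_simps)
  have 3: "complex_of_real q powi (tri i + (n + 1) * i) = of_real q powi (tri i + n * i) * of_real q powi i"
    using q_nonzero by (simp add: algebra_simps flip: power_int_add)
  have s: "(- 1 :: complex) powi (i - 1) = - ((- 1) powi i)"
    by (simp add: power_int_diff)
  have "of_real q powi n * regular_coeff q v (m + 1) (n + 1) (i - 1)
     = (of_real q powi n * of_real q powi (tri (i - 1) + (n + 1) * (i - 1)))
       * (- ((- 1) powi i)) * qfact_inv q (i - 1) / qpoch v q (m + i + 1)"
    by (simp add: regular_coeff_def s)
  also have "\<dots> = regular_coeff q v m (n + 1) i - regular_coeff q v m n i"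
    unfolding 1 2 regular_coeff_def 3 by (simp add: diff_divide_distrib algebra_simps)
  finally show ?thesis by simp
qed

lemma second_coeff_parameter:
  "second_coeff q v m n p
    = second_coeff q v (m + 1) n p - v * of_real q powi (m + 1) * second_coeff q v (m + 1) (n + 1) p"
proof -
  have 1: "qfact_inv q (p + m) = (1 - of_real q powi (m + 1 + p)) * qfact_inv q (p + m + 1)"
    using qfact_inv_step[OF q, of "p + m"] by (simp add: add_ac)
  have 2: "v * of_real q powi (m + 1) * (of_real q powi (n * p) * v powi (- (n + 1)))
     = of_real q powi (m + 1 + p) * (of_real q powi ((n - 1) * p) * v powi (- n))"
  proof -
    have "of_real q powi (m + 1) * of_real q powi (n * p) = complex_of_real q powi (m + 1 + p) * of_real q powi ((n - 1) * p)"
      using q_nonzero by (simp add: algebra_simps flip: power_int_add)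
    moreover have "v * v powi (- (n + 1)) = v powi (- n)"
      using v_nonzero power_int_add[of v 1 "- (n + 1)"] by simp
    ultimately show ?thesis by (metis (no_types, opaque_lifting) mult.assoc mult.left_commute)
  qed
  have "v * of_real q powi (m + 1) * second_coeff q v (m + 1) (n + 1) p
     = qpoch v q (- p) * qfact_inv q (p + m + 1) * (v * of_real q powi (m + 1) * (of_real q powi (n * p) * v powi (- (n + 1))))"
    by (simp add: second_coeff_def mult_ac add_ac)
  also have "\<dots> = second_coeff q v (m + 1) n p - second_coeff q v m n p"
    unfolding 2 second_coeff_def 1 by (simp add: algebra_simps)
  finally show ?thesis by simp
qed

lemma second_coeff_argument:
  "second_coeff q v m n p
    = second_coeff q v m (n + 1) p - of_real q powi n * second_coeff q v (m + 1) (n + 1) (p - 1)"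
proof -
  have 1: "qpoch v q (1 - p) = qpoch v q (- p) * (1 - v * of_real q powi (- p))"
    using qpoch_nonresonant_plus_1[OF v q_nonzero(2), of "- p"] by simp
  have vn: "v powi (- n) = v * v powi (- (n + 1))"
    using v_nonzero power_int_add[of v 1 "- (n + 1)"] by simp
  have 2: "complex_of_real q powi n * of_real q powi (n * (p - 1)) = of_real q powi (n * p)"
    using q_nonzero by (simp add: algebra_simps flip: power_int_add)
  have 3: "complex_of_real q powi ((n - 1) * p) = of_real q powi (n * p) * of_real q powi (- p)"
    using q_nonzero by (simp add: algebra_simps flip: power_int_add)
  have "of_real q powi n * second_coeff q v (m + 1) (n + 1) (p - 1)
    = qpoch v q (1 - p) * qfact_inv q (p + m) * (of_real q powi n * of_real q powi (n * (p - 1))) * v powi (- (n + 1))"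
    by (simp add: second_coeff_def mult_ac add_ac)
  also have "\<dots> = second_coeff q v m (n + 1) p - second_coeff q v m n p"
    unfolding 1 2 second_coeff_def 3 vn by (simp add: algebra_simps)
  finally show ?thesis by simp
qed

definition regular_series :: "int \<Rightarrow> int \<Rightarrow> complex fls" where "regular_series m n = Abs_fls (regular_coeff q v m n)"
definition second_series :: "int \<Rightarrow> int \<Rightarrow> complex fls" where "second_series m n = Abs_fls (second_coeff q v m n)"

lemma regular_series_nth: "fls_nth (regular_series m n) i = regular_coeff q v m n i"
  unfolding regular_series_def
  by (rule nth_Abs_fls_lower_bound[of 0]) (simp add: regular_coeff_def qfact_inv_neg q_nonzero)

lemma second_series_nth: "fls_nth (second_series m n) p = second_coeff q v m n p"
  unfolding second_series_def
  by (rule nth_Abs_fls_lower_bound[of "- m"]) (simp add: second_coeff_def qfact_inv_neg q_nonzero)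

lemma fls_X_times_nth: "fls_nth (fls_X * f) k = fls_nth f (k - 1)" for f :: "complex fls"
  by (simp add: fls_X_times_conv_shift)

lemma regular_series_parameter:
  "regular_series m n
    = regular_series (m + 1) n - fls_const (v * of_real q powi (m + 1)) * regular_series (m + 1) (n + 1)"
  by (intro fls_eqI) (simp add: regular_series_nth regular_coeff_parameter[of m n])

lemma second_series_parameter:
  "second_series m n
    = second_series (m + 1) n - fls_const (v * of_real q powi (m + 1)) * second_series (m + 1) (n + 1)"
  by (intro fls_eqI) (simp add: second_series_nth second_coeff_parameter[of m n])

lemma regular_series_argument:
  "regular_series m n
    = regular_series m (n + 1) - fls_const (of_real q powi n) * (fls_X * regular_series (m + 1) (n + 1))"
  by (intro fls_eqI) (simp add: regular_series_nth fls_X_times_nth regular_coeff_argument[of m n])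

lemma second_series_argument:
  "second_series m n
    = second_series m (n + 1) - fls_const (of_real q powi n) * (fls_X * second_series (m + 1) (n + 1))"
  by (intro fls_eqI) (simp add: second_series_nth fls_X_times_nth second_coeff_argument[of m n])

lemma fls_times_nth_bounds:
  fixes f g :: "complex fls"
  assumes f: "\<And>i. i < a \<Longrightarrow> fls_nth f i = 0" and g: "\<And>i. i < b \<Longrightarrow> fls_nth g i = 0"
  shows "fls_nth (f * g) k = (\<Sum>i=a..k - b. fls_nth f i * fls_nth g (k - i))"
proof (cases "f = 0 \<or> g = 0")
  case False
  then have "a \<le> fls_subdegree f" "b \<le> fls_subdegree g"
    using f g nth_fls_subdegree_nonzero by (meson not_le)+
  then have "(\<Sum>i=fls_subdegree f..k - fls_subdegree g. fls_nth f i * fls_nth g (k - i))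
     = (\<Sum>i=a..k - b. fls_nth f i * fls_nth g (k - i))"
    by (intro sum.mono_neutral_left) auto
  then show ?thesis by (simp add: fls_times_nth(2))
qed auto

lemma regular_second_nth:
  "fls_nth (regular_series m n * second_series m' n') k
    = (\<Sum>i=0..k + m'. regular_coeff q v m n i * second_coeff q v m' n' (k - i))"
  using fls_times_nth_bounds[of 0 "regular_series m n" "- m'" "second_series m' n'" k]
  by (simp add: regular_series_nth second_series_nth regular_coeff_def second_coeff_def qfact_inv_neg q_nonzero)

text \<open>Moving both factors by \<open>n\<close> replaces \<open>y\<close> by \<open>q\<^sup>n y\<close>, up to the constant \<open>v\<^bsup>-n\<^esup>\<close>.\<close>

lemma regular_second_nth_shift:
  "fls_nth (regular_series m n * second_series m' n) k
    = of_real q powi (n * k) * v powi (- n) * fls_nth (regular_series m 0 * second_series m' 0) k"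
proof -
  have "regular_coeff q v m n i * second_coeff q v m' n (k - i)
     = of_real q powi (n * k) * v powi (- n) * (regular_coeff q v m 0 i * second_coeff q v m' 0 (k - i))" for i
  proof -
    have "complex_of_real q powi (tri i + n * i) * of_real q powi ((n - 1) * (k - i))
        = of_real q powi (n * k) * (of_real q powi (tri i) * of_real q powi (- (k - i)))"
      using q_nonzero by (simp add: algebra_simps flip: power_int_add)
    then show ?thesis unfolding regular_coeff_def second_coeff_def by (simp add: algebra_simps)
  qed
  then show ?thesis by (simp add: regular_second_nth sum_distrib_left)
qed

definition casoratian :: "int \<Rightarrow> int \<Rightarrow> complex fls" where
  "casoratian m n = regular_series 0 0 * second_series m n - regular_series m n * second_series 0 0"

lemma casoratian_0_0: "casoratian 0 0 = 0"
  by (simp add: casoratian_def)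

text \<open>The two relations give the Casoratian of the points \<open>(1,1)\<close>, \<open>(0,1)\<close> as \<open>1/(v q)\<close> times that
  of \<open>(1,0)\<close>, \<open>(0,0)\<close>; on the other hand it arises from the latter by \<open>y \<mapsto> q y\<close> and
  division by \<open>v\<close>. Comparing coefficients, \<open>q\<^bsup>k+1\<^esup> = 1\<close> wherever the \<open>k\<close>-th coefficient is nonzero,
  which leaves only \<open>k = -1\<close>.\<close>

lemma casoratian_1_0: "fls_nth (casoratian 1 0) k = (if k = - 1 then of_real q else 0)"
proof (cases "k = - 1")
  case True
  have "qpoch v q 1 = 1 - v"
    using qpoch_nonresonant_plus_1[OF v q_nonzero(2), of 0] by simp
  moreover have "v \<noteq> 1" using v by (force simp: nonresonant_def dest: spec[of _ 0])
  ultimately show ?thesis using True by (simp add: casoratian_def regular_second_nth regular_coeff_def second_coeff_def)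
next
  case False
  define c where "c = v * complex_of_real q"
  have c: "c \<noteq> 0" using v_nonzero q_nonzero by (simp add: c_def)
  have Ra: "regular_series 0 0 = regular_series 1 0 - fls_const c * regular_series 1 1"
    and Sa: "second_series 0 0 = second_series 1 0 - fls_const c * second_series 1 1"
    using regular_series_parameter[of 0 0] second_series_parameter[of 0 0] by (simp_all add: c_def)
  have Rb: "regular_series 0 1 = regular_series 0 0 + fls_X * regular_series 1 1"
    and Sb: "second_series 0 1 = second_series 0 0 + fls_X * second_series 1 1"
    using regular_series_argument[of 0 0] second_series_argument[of 0 0] by (simp_all add: algebra_simps)
  have "fls_const c * (regular_series 0 1 * second_series 1 1 - regular_series 1 1 * second_series 0 1) = casoratian 1 0"
    unfolding casoratian_def Rb Sb Ra Sa by (simp add: algebra_simps)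
  then have "fls_nth (casoratian 1 0) k = c * (fls_nth (regular_series 0 1 * second_series 1 1) k - fls_nth (regular_series 1 1 * second_series 0 1) k)"
    by (metis fls_minus_nth fls_mult_const_nth(1))
  also have "\<dots> = c * (of_real q powi k / v) * fls_nth (casoratian 1 0) k"
    using regular_second_nth_shift[of 0 1 1 k] regular_second_nth_shift[of 1 1 0 k]
    by (simp add: casoratian_def algebra_simps power_int_minus divide_inverse)
  also have "c * (of_real q powi k / v) = of_real q powi (k + 1)"
    using v_nonzero q_nonzero by (simp add: c_def power_int_add)
  finally have *: "(1 - of_real q powi (k + 1)) * fls_nth (casoratian 1 0) k = 0"
    by (simp add: algebra_simps)
  have "of_real q powi (k + 1) \<noteq> (1 :: complex)"
  proof (cases "k + 1 > 0")
    case True then show ?thesis using powi_q_neq_1[OF q] by simp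
  next
    case F: False
    then have "of_real q powi (- (k + 1)) \<noteq> (1 :: complex)"
      using powi_q_neq_1[OF q, of "- (k + 1)"] False by simp
    then show ?thesis by (metis power_int_minus inverse_1)
  qed
  with * show ?thesis using False by simp
qed

lemma casoratian_parameter:
  "fls_nth (casoratian m n) k
    = fls_nth (casoratian (m + 1) n) k
      - v * of_real q powi (m + 1) * fls_nth (casoratian (m + 1) (n + 1)) k"
proof -
  have "casoratian m n = casoratian (m + 1) n - fls_const (v * of_real q powi (m + 1)) * casoratian (m + 1) (n + 1)"
    unfolding casoratian_def by (subst regular_series_parameter[of m n], subst second_series_parameter[of m n]) (simp add: algebra_simps)
  then show ?thesis by (metis fls_minus_nth fls_mult_const_nth(1))
qed

lemma casoratian_argument:
  "fls_nth (casoratian m n) k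
    = fls_nth (casoratian m (n + 1)) k - of_real q powi n * fls_nth (casoratian (m + 1) (n + 1)) (k - 1)"
proof -
  have "casoratian m n = casoratian m (n + 1) - fls_const (of_real q powi n) * (fls_X * casoratian (m + 1) (n + 1))"
    unfolding casoratian_def by (subst regular_series_argument[of m n], subst second_series_argument[of m n]) (simp add: algebra_simps)
  then show ?thesis by (metis fls_minus_nth fls_mult_const_nth(1) fls_X_times_nth)
qed

lemma casoratian_vanish_above:
  "k + max m 0 \<ge> max \<bar>n\<bar> \<bar>m - n\<bar> \<Longrightarrow> fls_nth (casoratian m n) k
    = 0"
  by (rule contiguous_coeff_vanish[OF q_nonzero(1) v_nonzero, of "\<lambda>m n k. fls_nth (casoratian m n) k"])
    (simp_all add: casoratian_0_0 casoratian_1_0 casoratian_parameter[symmetric] casoratian_argument[symmetric])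

lemma casoratian_vanish_below: "k + max m 0 < 0 \<Longrightarrow> fls_nth (casoratian m n) k = 0"
  by (simp add: casoratian_def regular_second_nth)

end

section \<open>The coefficients of the Casoratian\<close>

lemma qpow_mult_int:
  assumes "0 < q"
  shows "qpow q (of_int k * z) = qpow q z powi k"
  using assms by (simp add: powr_def exp_power_int mult.assoc)

lemma qpow_of_int: "0 < q \<Longrightarrow> qpow q (of_int k) = of_real q powi k"
  using qpow_mult_int[of q k 1] by simp

lemma qpow_add: "qpow q (z + w) = qpow q z * qpow q w"
  by (rule powr_add)

lemma qpow_add_int: "0 < q \<Longrightarrow> qpow q (z + of_int k) = qpow q z * of_real q powi k"
  by (simp add: qpow_add qpow_of_int)

lemma qpoch_minus_power:
  assumes q: "0 < q" "q < 1" and j: "j \<ge> 0"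
  shows "qpoch (of_real q powi (- j)) q (int i) * qfact_inv q j
     = (- 1) powi int i * of_real q powi (tri (int i) - j * int i) * qfact_inv q (j - int i)"
proof (induction i)
  case (Suc i)
  have q0: "complex_of_real q \<noteq> 0" using q by simp
  have 1: "qfact_inv q (j - int (Suc i)) = (1 - of_real q powi (j - int i)) * qfact_inv q (j - int i)"
    using qfact_inv_step[OF q, of "j - int (Suc i)"] by simp
  have 2: "qpoch (of_real q powi (- j)) q (int (Suc i))
     = qpoch (of_real q powi (- j)) q (int i) * (1 - of_real q powi (int i - j))"
    using qpoch_plus_1[of q "int i" "of_real q powi (- j)"] q power_int_add[of "complex_of_real q" "- j" "int i"]
    by (simp add: add.commute)
  have 3: "1 - of_real q powi (int i - j) = - (complex_of_real q powi (int i - j)) * (1 - of_real q powi (j - int i))"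
    using q0 by (simp add: algebra_simps flip: power_int_add)
  have t: "tri (int (Suc i)) = tri (int i) + int i"
    using tri_plus_1[of "int i"] by (simp add: add.commute)
  have 4: "complex_of_real q powi (tri (int (Suc i)) - j * int (Suc i))
     = of_real q powi (tri (int i) - j * int i) * of_real q powi (int i - j)"
    using q0 unfolding t by (subst power_int_add[symmetric]) (simp_all add: algebra_simps)
  have 5: "(- 1 :: complex) powi int (Suc i) = - ((- 1) powi int i)"
    by (simp only: power_int_of_nat) simp
  have "qpoch (of_real q powi (- j)) q (int (Suc i)) * qfact_inv q j
     = (qpoch (of_real q powi (- j)) q (int i) * qfact_inv q j) * (1 - of_real q powi (int i - j))"
    unfolding 2 by simp
  also have "\<dots> = (- 1) powi int (Suc i) * of_real q powi (tri (int (Suc i)) - j * int (Suc i)) * qfact_inv q (j - int (Suc i))"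
    unfolding Suc.IH 1 3 4 5 by simp
  finally show ?case .
qed auto

text \<open>The factor \<open>1/(q;q)\<^sub>j\<close>, which accompanies the series in both \<open>A\<close> and \<open>B\<close>, splits with
  \<open>(q\<^bsup>-j\<^esup>;q)\<^sub>i\<close> into \<open>1/(q;q)\<^bsub>j-i\<^esub>\<close>: this makes the sum a Cauchy product.\<close>

lemma qhyp_terminating:
  assumes q: "0 < q" "q < 1" and j: "j \<ge> 0"
  shows "qfact_inv q j * qhyp [of_real q powi (- j), b] [c] q x
     = (\<Sum>i=0..j. (- 1) powi i * of_real q powi (tri i - j * i) * qfact_inv q (j - i) * qfact_inv q i
          * qpoch b q i / qpoch c q i * x powi i)"
proof -
  let ?t = "\<lambda>i. (- 1) powi i * of_real q powi (tri i - j * i) * qfact_inv q (j - i) * qfact_inv q i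
          * qpoch b q i / qpoch c q i * x powi i"
  let ?u = "\<lambda>i. qpoch (of_real q powi (- j)) q (int i) * qpoch b q (int i) * qfact_inv q (int i)
      / qpoch c q (int i) * x ^ i"
  have tu: "?t (int i) = qfact_inv q j * ?u i" for i
    unfolding qpoch_minus_power[OF q j, of i, symmetric] by simp
  have nz: "qfact_inv q j \<noteq> 0"
  proof -
    have "qpoch (of_real q) q j \<noteq> 0"
    proof -
      have "complex_of_real q ^ Suc i \<noteq> 1" for i
        using powi_q_neq_1[OF q, of "int (Suc i)"] by (simp only: power_int_of_nat) simp
      then show ?thesis using j by (simp add: qpoch_def)
    qed
    then show ?thesis by (simp add: qfact_inv_def)
  qed
  have u0: "?u i = 0" if "i \<notin> {..nat j}" for i
  proof -
    have "?t (int i) = 0" using that q by (simp add: qfact_inv_neg)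
    then show ?thesis unfolding tu using nz by simp
  qed
  have "qhyp [of_real q powi (- j), b] [c] q x = (\<Sum>i. ?u i)"
    unfolding qhyp_def by (simp add: qfact_inv_def mult_ac divide_inverse)
  also have "\<dots> = (\<Sum>i\<le>nat j. ?u i)"
    by (rule suminf_finite) (use u0 in auto)
  finally have "qfact_inv q j * qhyp [of_real q powi (- j), b] [c] q x = (\<Sum>i\<le>nat j. ?t (int i))"
    by (simp only: sum_distrib_left tu)
  also have "\<dots> = (\<Sum>i=0..j. ?t i)"
    by (rule sum.reindex_bij_witness[where i = nat and j = int]) (use j in auto)
  finally show ?thesis .
qed

lemma qpoch_shift:
  assumes v: "nonresonant q v" and q: "q \<noteq> 0"
  shows "qpoch v q (m + 1) = (1 - v) * qpoch (v * of_real q) q m"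
proof -
  have nr: "nonresonant q (v * of_real q)" using nonresonant_mult_power[OF v q, of 1] by simp
  have pw: "v * of_real q * of_real q powi i = v * of_real q powi (i + 1)" for i
    using q by (simp add: power_int_add)
  have v_ne_1: "1 - v \<noteq> 0" using v by (force simp: nonresonant_def dest: spec[of _ 0])
  have step: "qpoch v q (i + 1 + 1) = (1 - v) * qpoch (v * of_real q) q (i + 1) \<longleftrightarrow>
     qpoch v q (i + 1) = (1 - v) * qpoch (v * of_real q) q i" for i
  proof -
    have "1 - v * of_real q powi (i + 1) \<noteq> 0" using v by (auto simp: nonresonant_def)
    then show ?thesis
      unfolding qpoch_nonresonant_plus_1[OF v q, of "i + 1"] qpoch_nonresonant_plus_1[OF nr q, of i] pw
      by auto
  qed
  show ?thesis
  proof (induction m rule: int_induct[where k = 0])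
    case base
    then show ?case using qpoch_nonresonant_plus_1[OF v q, of 0] by simp
  next
    case (step1 i) then show ?case using step[of i] by simp
  next
    case (step2 i) then show ?case using step[of "i - 1"] by simp
  qed
qed

text \<open>Inverting each factor \<open>1 - v q\<^bsup>-t\<^esup> = - v q\<^bsup>-t\<^esup> (1 - q\<^sup>t / v)\<close>. It accounts for the
  parameter \<open>q\<^bsup>2-\<nu>\<^esup>\<close> and the power of \<open>q\<close> in the definition of \<open>B\<close>.\<close>

lemma qpoch_reflect:
  assumes v: "nonresonant q v" and q: "q \<noteq> 0"
  shows "qpoch v q (- int k) * qpoch (of_real q / v) q (int k)
     = (- 1) powi int k * of_real q powi (tri (int k) + int k) * v powi (- int k)"
proof (induction k)
  case (Suc k)
  have v_ne_0: "v \<noteq> 0" using v by (simp add: nonresonant_def)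
  have 1: "qpoch v q (- int k) = qpoch v q (- int (Suc k)) * (1 - v * of_real q powi (- int (Suc k)))"
    using qpoch_nonresonant_plus_1[OF v q, of "- int (Suc k)"] by simp
  have nz: "1 - v * of_real q powi (- int (Suc k)) \<noteq> 0" using v by (auto simp: nonresonant_def)
  have 2: "qpoch (of_real q / v) q (int (Suc k)) = qpoch (of_real q / v) q (int k) * (1 - of_real q powi int (Suc k) / v)"
    using qpoch_plus_1[of q "int k" "of_real q / v"] q by (simp add: add.commute power_int_add)
  have 3: "1 - of_real q powi int (Suc k) / v
      = - (of_real q powi int (Suc k) / v) * (1 - v * of_real q powi (- int (Suc k)))"
  proof -
    have "complex_of_real q powi int (Suc k) * of_real q powi (- int (Suc k)) = 1"
      using q by (subst power_int_add[symmetric]) auto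
    then show ?thesis using v_ne_0 by (simp add: field_simps del: of_nat_Suc)
  qed
  have 4: "complex_of_real q powi (tri (int (Suc k)) + int (Suc k)) = of_real q powi (tri (int k) + int k) * of_real q powi int (Suc k)"
  proof -
    have "tri (int (Suc k)) = tri (int k) + int k" using tri_plus_1[of "int k"] by (simp add: add.commute)
    then show ?thesis using q by (subst power_int_add[symmetric]) (simp_all add: algebra_simps)
  qed
  have 5: "v powi (- int (Suc k)) = v powi (- int k) / v"
  proof -
    have e: "- int (Suc k) = - int k - 1" by simp
    show ?thesis unfolding e by (subst power_int_diff) (use v_ne_0 in simp_all)
  qed
  have 6: "(- 1 :: complex) powi int (Suc k) = - ((- 1) powi int k)"
    by (simp only: power_int_of_nat) simp
  have "qpoch v q (- int (Suc k)) * qpoch (of_real q / v) q (int (Suc k))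
      = (qpoch v q (- int k) * qpoch (of_real q / v) q (int k)) * (- (of_real q powi int (Suc k) / v))"
    unfolding 1 2 3 by simp
  also have "\<dots> = (- 1) powi int (Suc k) * of_real q powi (tri (int (Suc k)) + int (Suc k)) * v powi (- int (Suc k))"
    unfolding Suc.IH 4 5 6 by simp
  finally show ?case .
qed auto

context
  fixes q :: real and \<nu> v :: complex
  assumes q: "0 < q" "q < 1" and v: "nonresonant q v" and \<nu>: "qpow q (\<nu> - 1) = v"
begin

lemma q_ne_0:
  "q \<noteq> 0" "complex_of_real q \<noteq> 0" and v_ne_0: "v \<noteq> 0" and v_ne_1: "1 - v \<noteq> 0"
  using q v by (force simp: nonresonant_def dest: spec[of _ 0])+

lemma qpow_\<nu>: "qpow q \<nu> = v * of_real q"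
  using qpow_add_int[OF q(1), of "\<nu> - 1" 1] \<nu> by simp

lemma qpow_\<nu>_int: "qpow q (\<nu> + of_int k) = v * of_real q powi (k + 1)"
  using qpow_add_int[OF q(1), of \<nu> k] qpow_\<nu> q_ne_0 by (simp add: power_int_add)

text \<open>In the summand, \<open>(v;q)\<^bsub>m-j\<^esub>\<close> absorbs \<open>(v q\<^bsup>m-j\<^esup>;q)\<^sub>i\<close> and becomes \<open>(v;q)\<^bsub>m-j+i\<^esub>\<close>, which
  depends on \<open>j - i\<close> only and so belongs to the second solution at \<open>(m,n)\<close>; the remaining
  factors in \<open>i\<close> are the Bessel coefficients at \<open>(0,0)\<close>.\<close>

lemma A3_eq_coeff:
  "A3 q m n \<nu> j = qpoch v q (m + 1) * fls_nth (regular_series q v 0 0 * second_series q v m n) (j - m)"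
proof (cases "j \<ge> 0")
  case False
  then show ?thesis using A3_neg[of q j] q_ne_0 by (simp add: regular_second_nth[OF q v])
next
  case j: True
  define c where "c = complex_of_real q powi ((n - 1) * (j - m)) * v powi (- n)"
  have "qpow q (of_int ((j - m + 1) * (n - 1) + 1) - of_int n * \<nu>) = c"
  proof -
    have "complex_of_int ((j - m + 1) * (n - 1) + 1) - of_int n * \<nu>
       = of_int (- n) * (\<nu> - 1) + of_int ((n - 1) * (j - m))"
      by (simp add: algebra_simps)
    then show ?thesis
      by (simp only: qpow_add_int[OF q(1)] qpow_mult_int[OF q(1)] \<nu> c_def) (simp add: mult.commute)
  qed
  moreover have "qpow q (\<nu> + of_int (m - j - 1)) = v * of_real q powi (m - j)"
    using qpow_\<nu>_int[of "m - j - 1"] by simp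
  ultimately have "A3 q m n \<nu> j = qpoch (v * of_real q) q m * qpoch v q (m - j) * c *
     (qfact_inv q j * qhyp [of_real q powi (- j), v * of_real q powi (m - j)] [v * of_real q] q
        (of_real q powi (j - n + 1)))"
    unfolding A3_def \<nu> qpow_\<nu> by (simp add: qfact_inv_def)
  also have "\<dots> = (\<Sum>i=0..j. qpoch (v * of_real q) q m * qpoch v q (m - j) * c *
      ((- 1) powi i * of_real q powi (tri i - j * i) * qfact_inv q (j - i) * qfact_inv q i
          * qpoch (v * of_real q powi (m - j)) q i / qpoch (v * of_real q) q i * (of_real q powi (j - n + 1)) powi i))"
    unfolding qhyp_terminating[OF q j] sum_distrib_left ..
  also have "\<dots> = (\<Sum>i=0..j. qpoch v q (m + 1) * (regular_coeff q v 0 0 i * second_coeff q v m n (j - m - i)))"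
  proof (rule sum.cong)
    fix i assume i: "i \<in> {0..j}"
    have 1: "qpoch v q (m - j) * qpoch (v * of_real q powi (m - j)) q i = qpoch v q (m - j + i)"
      using qpoch_add_nat[of q v "m - j" "nat i"] v q_ne_0 i by (simp add: nonresonant_def)
    have 2: "qpoch v q (m + 1) / qpoch v q (i + 1) = qpoch (v * of_real q) q m / qpoch (v * of_real q) q i"
      using v_ne_1 by (simp add: qpoch_shift[OF v q_ne_0(1)])
    have 3: "of_real q powi (tri i - j * i) * (of_real q powi (j - n + 1)) powi i * c
       = of_real q powi (tri i) * of_real q powi ((n - 1) * (j - m - i)) * v powi (- n)"
      unfolding c_def using q_ne_0 by (simp add: algebra_simps flip: power_int_add power_int_mult)
    have "qpoch (v * of_real q) q m * qpoch v q (m - j) * c *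
      ((- 1) powi i * of_real q powi (tri i - j * i) * qfact_inv q (j - i) * qfact_inv q i
          * qpoch (v * of_real q powi (m - j)) q i / qpoch (v * of_real q) q i * (of_real q powi (j - n + 1)) powi i)
     = (qpoch (v * of_real q) q m / qpoch (v * of_real q) q i)
       * (qpoch v q (m - j) * qpoch (v * of_real q powi (m - j)) q i) * (- 1) powi i * qfact_inv q (j - i) * qfact_inv q i
       * (of_real q powi (tri i - j * i) * (of_real q powi (j - n + 1)) powi i * c)"
      by simp
    also have "\<dots> = qpoch v q (m + 1) * (regular_coeff q v 0 0 i * second_coeff q v m n (j - m - i))"
      unfolding 1 2[symmetric] 3 by (simp add: regular_coeff_def second_coeff_def algebra_simps)
    finally show "qpoch (v * of_real q) q m * qpoch v q (m - j) * c *
      ((- 1) powi i * of_real q powi (tri i - j * i) * qfact_inv q (j - i) * qfact_inv q i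
          * qpoch (v * of_real q powi (m - j)) q i / qpoch (v * of_real q) q i * (of_real q powi (j - n + 1)) powi i)
      = qpoch v q (m + 1) * (regular_coeff q v 0 0 i * second_coeff q v m n (j - m - i))" .
  qed simp
  also have "\<dots> = qpoch v q (m + 1) * fls_nth (regular_series q v 0 0 * second_series q v m n) (j - m)"
    by (simp add: regular_second_nth[OF q v] sum_distrib_left)
  finally show ?thesis .
qed

text \<open>Here the roles are exchanged: the lower parameter \<open>q\<^bsup>\<nu>+m\<^esup>\<close> carries \<open>m\<close>, so the Bessel
  coefficient is taken at \<open>(m,n)\<close> and the second solution at \<open>(0,0)\<close>.\<close>

lemma B3_eq_coeff:
  "B3 q m n \<nu> k = qpoch v q (m + 1) * fls_nth (regular_series q v m n * second_series q v 0 0) k"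
proof (cases "k \<ge> 0")
  case False
  then show ?thesis using B3_neg[of q k] q_ne_0 by (simp add: regular_second_nth[OF q v])
next
  case k: True
  define p where "p = qpoch (of_real q / v) q k"
  have p: "qpoch v q (- k) * p = (- 1) powi k * of_real q powi (tri k + k) * v powi (- k)"
    using qpoch_reflect[OF v q_ne_0(1), of "nat k"] k by (simp add: p_def)
  then have "p \<noteq> 0" using q_ne_0 v_ne_0 by auto
  with p have ip: "1 / p * ((- 1) powi k * of_real q powi (tri k + k) * v powi (- k)) = qpoch v q (- k)"
    by (simp add: field_simps)
  have "qpow q (2 - \<nu>) = of_real q / v"
  proof -
    have "2 - \<nu> = of_int (- 1) * (\<nu> - 1) + of_int 1" by simp
    then show ?thesis
      by (simp only: qpow_add_int[OF q(1)] qpow_mult_int[OF q(1)] \<nu>)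
        (simp add: power_int_minus divide_inverse)
  qed
  moreover have "qpow q (of_int (k * (k + 1)) / 2 - of_int k * \<nu>) = of_real q powi (tri k) * v powi (- k)"
  proof -
    have "2 * tri k = k * (k - 1)" unfolding tri_def by simp
    then have "k * (k + 1) = 2 * (tri k + k)"
      by (simp add: algebra_simps)
    then have "complex_of_int (k * (k + 1)) = of_int (2 * (tri k + k))"
      by (simp only:)
    then have "complex_of_int (k * (k + 1)) / 2 = of_int (tri k + k)"
      by simp
    then have "complex_of_int (k * (k + 1)) / 2 - of_int k * \<nu> = of_int (- k) * (\<nu> - 1) + of_int (tri k)"
      by (simp add: algebra_simps)
    then show ?thesis
      by (simp only: qpow_add_int[OF q(1)] qpow_mult_int[OF q(1)] \<nu>) (simp add: mult.commute)
  qed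
  moreover have "qpow q (\<nu> - of_int k - 1) = v * of_real q powi (- k)"
    using qpow_\<nu>_int[of "- k - 1"] by (simp add: algebra_simps)
  ultimately have "B3 q m n \<nu> k = 1 / p * (- 1) powi k * (of_real q powi (tri k) * v powi (- k)) *
     (qfact_inv q k * qhyp [of_real q powi (- k), v * of_real q powi (- k)] [v * of_real q powi (m + 1)] q
        (of_real q powi (k + n + 1)))"
    unfolding B3_def qpow_\<nu>_int by (simp add: qfact_inv_def p_def)
  also have "1 / p * (- 1) powi k * (of_real q powi (tri k) * v powi (- k)) = qpoch v q (- k) * of_real q powi (- k)"
    unfolding ip[symmetric] using q_ne_0 by (simp add: power_int_add power_int_minus)
  also have "qpoch v q (- k) * of_real q powi (- k) * (qfact_inv q k * qhyp [of_real q powi (- k), v * of_real q powi (- k)] [v * of_real q powi (m + 1)] q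
        (of_real q powi (k + n + 1)))
   = (\<Sum>i=0..k. qpoch v q (- k) * of_real q powi (- k) *
      ((- 1) powi i * of_real q powi (tri i - k * i) * qfact_inv q (k - i) * qfact_inv q i
          * qpoch (v * of_real q powi (- k)) q i / qpoch (v * of_real q powi (m + 1)) q i * (of_real q powi (k + n + 1)) powi i))"
    unfolding qhyp_terminating[OF q k] sum_distrib_left ..
  also have "\<dots> = (\<Sum>i=0..k. qpoch v q (m + 1) * (regular_coeff q v m n i * second_coeff q v 0 0 (k - i)))"
  proof (rule sum.cong)
    fix i assume i: "i \<in> {0..k}"
    have 1: "qpoch v q (- k) * qpoch (v * of_real q powi (- k)) q i = qpoch v q (- k + i)"
      using qpoch_add_nat[of q v "- k" "nat i"] v q_ne_0 i by (simp add: nonresonant_def)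
    have 2: "1 / qpoch (v * of_real q powi (m + 1)) q i = qpoch v q (m + 1) / qpoch v q (m + i + 1)"
      using qpoch_add_nat[of q v "m + 1" "nat i"] v q_ne_0 i qpoch_nonresonant_nonzero[OF v q_ne_0(1), of "m + 1"]
      by (simp add: nonresonant_def add_ac)
    have 3: "of_real q powi (- k) * of_real q powi (tri i - k * i) * (of_real q powi (k + n + 1)) powi i
       = complex_of_real q powi (tri i + n * i) * of_real q powi (i - k)"
      using q_ne_0 by (simp add: algebra_simps flip: power_int_add power_int_mult)
    have "qpoch v q (- k) * of_real q powi (- k) *
      ((- 1) powi i * of_real q powi (tri i - k * i) * qfact_inv q (k - i) * qfact_inv q i
          * qpoch (v * of_real q powi (- k)) q i / qpoch (v * of_real q powi (m + 1)) q i * (of_real q powi (k + n + 1)) powi i)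
     = (1 / qpoch (v * of_real q powi (m + 1)) q i)
       * (qpoch v q (- k) * qpoch (v * of_real q powi (- k)) q i) * (- 1) powi i * qfact_inv q (k - i) * qfact_inv q i
       * (of_real q powi (- k) * of_real q powi (tri i - k * i) * (of_real q powi (k + n + 1)) powi i)"
      by simp
    also have "\<dots> = qpoch v q (m + 1) * (regular_coeff q v m n i * second_coeff q v 0 0 (k - i))"
      unfolding 1 2 3 by (simp add: regular_coeff_def second_coeff_def algebra_simps)
    finally show "qpoch v q (- k) * of_real q powi (- k) *
      ((- 1) powi i * of_real q powi (tri i - k * i) * qfact_inv q (k - i) * qfact_inv q i
          * qpoch (v * of_real q powi (- k)) q i / qpoch (v * of_real q powi (m + 1)) q i * (of_real q powi (k + n + 1)) powi i)
      = qpoch v q (m + 1) * (regular_coeff q v m n i * second_coeff q v 0 0 (k - i))" .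
  qed simp
  also have "\<dots> = qpoch v q (m + 1) * fls_nth (regular_series q v m n * second_series q v 0 0) k"
    by (simp add: regular_second_nth[OF q v] sum_distrib_left)
  finally show ?thesis .
qed

lemma A3_minus_B3:
  "A3 q m n \<nu> (k + m) - B3 q m n \<nu> k
    = qpoch v q (m + 1) * fls_nth (casoratian q v m n) k"
  using A3_eq_coeff[of m n "k + m"] B3_eq_coeff[of m n k]
  by (simp add: casoratian_def[OF q v] algebra_simps)

end

section \<open>The Casoratian as a function\<close>

context
  fixes q :: real and v :: complex
  assumes q: "0 < q" "q < 1" and v: "nonresonant q v"
begin

text \<open>The range of \<open>k\<close> contains the support of the Casoratian, so this is its value at \<open>y\<close>.\<close>

definition casoratian_sum :: "complex \<Rightarrow> int \<Rightarrow> int \<Rightarrow> complex" where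
  "casoratian_sum y m n = (\<Sum>k=- max m 0..P3_deg m n - max m 0. fls_nth (casoratian q v m n) k * y powi k)"

lemma casoratian_sum_eq:
  assumes "N \<ge> \<bar>m\<bar> + \<bar>n\<bar>"
  shows "(\<Sum>k=- N..N. fls_nth (casoratian q v m n) k * y powi k) = casoratian_sum y m n"
  unfolding casoratian_sum_def
proof (rule sum.mono_neutral_right)
  show "{- max m 0..P3_deg m n - max m 0} \<subseteq> {- N..N}"
    using assms by (auto simp: P3_deg_def)
  show "\<forall>k\<in>{- N..N} - {- max m 0..P3_deg m n - max m 0}. fls_nth (casoratian q v m n) k * y powi k = 0"
  proof
    fix k assume "k \<in> {- N..N} - {- max m 0..P3_deg m n - max m 0}"
    then have "k + max m 0 < 0 \<or> k + max m 0 \<ge> max \<bar>n\<bar> \<bar>m - n\<bar>"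
      unfolding P3_deg_def by auto
    then show "fls_nth (casoratian q v m n) k * y powi k = 0"
      using casoratian_vanish_below[OF q v, of k m n] casoratian_vanish_above[OF q v, of n m k] by auto
  qed
qed simp

lemma contiguous_casoratian_sum:
  assumes y: "y \<noteq> 0"
  shows "contiguous (of_real q) v y (casoratian_sum y)"
  unfolding contiguous_def
proof (intro conjI allI)
  fix m n :: int
  \<comment> \<open>a margin wide enough for the four vertices involved and a shift of the index by one\<close>
  define N where "N = \<bar>m\<bar> + \<bar>n\<bar> + 4"
  have w: "casoratian_sum y m' n' = (\<Sum>k=- N..N. fls_nth (casoratian q v m' n') k * y powi k)"
    if "m' = m \<or> m' = m + 1" "n' = n \<or> n' = n + 1" for m' n'
    by (rule casoratian_sum_eq[symmetric]) (use that in \<open>auto simp: N_def\<close>)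
  show "casoratian_sum y m n = casoratian_sum y (m + 1) n
      - v * of_real q powi (m + 1) * casoratian_sum y (m + 1) (n + 1)"
    by (simp add: w casoratian_parameter[OF q v, of m n] algebra_simps sum_subtractf sum_distrib_left)
  have "(\<Sum>k=- N..N. fls_nth (casoratian q v (m + 1) (n + 1)) (k - 1) * y powi k)
      = y * casoratian_sum y (m + 1) (n + 1)"
  proof -
    have "(\<Sum>k=- N..N. fls_nth (casoratian q v (m + 1) (n + 1)) (k - 1) * y powi k)
      = (\<Sum>k=- N - 1..N - 1. fls_nth (casoratian q v (m + 1) (n + 1)) k * y powi (k + 1))"
      by (rule sum.reindex_bij_witness[where i = "\<lambda>k. k + 1" and j = "\<lambda>k. k - 1"]) auto
    also have "\<dots> = y * (\<Sum>k=- N - 1..N - 1. fls_nth (casoratian q v (m + 1) (n + 1)) k * y powi k)"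
      using y by (simp add: sum_distrib_left power_int_add mult_ac)
    also have "(\<Sum>k=- N - 1..N - 1. fls_nth (casoratian q v (m + 1) (n + 1)) k * y powi k)
       = (\<Sum>k=- (N - 1)..N - 1. fls_nth (casoratian q v (m + 1) (n + 1)) k * y powi k)"
    proof (rule sum.mono_neutral_right)
      show "\<forall>k\<in>{- N - 1..N - 1} - {- (N - 1)..N - 1}. fls_nth (casoratian q v (m + 1) (n + 1)) k * y powi k = 0"
      proof
        fix k assume "k \<in> {- N - 1..N - 1} - {- (N - 1)..N - 1}"
        then have "k + max (m + 1) 0 < 0" by (auto simp: N_def)
        then show "fls_nth (casoratian q v (m + 1) (n + 1)) k * y powi k = 0"
          using casoratian_vanish_below[OF q v] by simp
      qed
    qed auto
    also have "\<dots> = casoratian_sum y (m + 1) (n + 1)"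
      by (rule casoratian_sum_eq) (auto simp: N_def)
    finally show ?thesis .
  qed
  then have "of_real q powi n * y * casoratian_sum y (m + 1) (n + 1)
     = (\<Sum>k=- N..N. of_real q powi n * fls_nth (casoratian q v (m + 1) (n + 1)) (k - 1) * y powi k)"
    by (simp add: sum_distrib_left[symmetric] mult.assoc)
  then show "casoratian_sum y m n = casoratian_sum y m (n + 1)
      - of_real q powi n * y * casoratian_sum y (m + 1) (n + 1)"
    by (simp add: w casoratian_argument[OF q v, of m n] left_diff_distrib sum_subtractf)
qed

lemma casoratian_sum_0_0: "casoratian_sum y 0 0 = 0"
  by (simp add: casoratian_sum_def P3_deg_def)

lemma casoratian_sum_1_0: "casoratian_sum y 1 0 = of_real q / y"
  by (simp add: casoratian_sum_def P3_deg_def casoratian_1_0[OF q v] power_int_minus divide_inverse)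

lemma casoratian_sum_m1_0:
  assumes y: "y \<noteq> 0"
  shows "casoratian_sum y (- 1) 0 = - 1"
proof -
  have "v \<noteq> 0" "complex_of_real q \<noteq> 0" using v q by (auto simp: nonresonant_def)
  have a: "casoratian_sum y m n = casoratian_sum y (m + 1) n
      - v * of_real q powi (m + 1) * casoratian_sum y (m + 1) (n + 1)"
    and b: "casoratian_sum y m n = casoratian_sum y m (n + 1)
      - of_real q powi n * y * casoratian_sum y (m + 1) (n + 1)" for m n
    using contiguous_casoratian_sum[OF y] unfolding contiguous_def by blast+
  have 1: "v * casoratian_sum y 1 1 = 1 / y"
    using a[of 0 0] \<open>complex_of_real q \<noteq> 0\<close> y by (simp add: casoratian_sum_0_0 casoratian_sum_1_0 field_simps)
  have "casoratian_sum y 0 1 = y * casoratian_sum y 1 1"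
    using b[of 0 0] by (simp add: casoratian_sum_0_0)
  then have "v * casoratian_sum y 0 1 = 1"
    using 1 y by (simp add: field_simps)
  then show ?thesis
    using a[of "- 1" 0] by (simp add: casoratian_sum_0_0)
qed

text \<open>With \<open>k = j - max m 0\<close> the two indices in the definition of \<open>P\<close> are \<open>k + m\<close> and \<open>k\<close>,
  because \<open>max m 0 + min m 0 = m\<close>.\<close>

lemma P3_eq_casoratian_sum:
  assumes \<nu>: "qpow q (\<nu> - 1) = v" and x: "x \<noteq> 0"
  defines "y \<equiv> of_real q * (x / 2)\<^sup>2"
  shows "P3 q m n \<nu> x = qpoch v q (m + 1) * y powi max m 0 * casoratian_sum y m n"
proof -
  have y: "y \<noteq> 0" using q x by (simp add: y_def)
  have "P3 q m n \<nu> x = (\<Sum>j=0..P3_deg m n. qpoch v q (m + 1) * y powi max m 0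
      * (fls_nth (casoratian q v m n) (j - max m 0) * y powi (j - max m 0)))"
    unfolding P3_def
  proof (rule sum.cong)
    fix j assume j: "j \<in> {0..P3_deg m n}"
    have "j + min m 0 = j - max m 0 + m" by (simp add: max_def min_def)
    then have 1: "A3 q m n \<nu> (j + min m 0) - B3 q m n \<nu> (j - max m 0)
        = qpoch v q (m + 1) * fls_nth (casoratian q v m n) (j - max m 0)"
      using A3_minus_B3[OF q v \<nu>, of m n "j - max m 0"] by (simp only:)
    have "(x / 2) ^ (2 * nat j) * of_real q ^ nat j = y ^ nat j"
      unfolding y_def power_mult power_mult_distrib[of "of_real q"] by (rule mult.commute)
    also have "\<dots> = y powi j"
      using j by (simp add: power_int_def)
    also have "\<dots> = y powi max m 0 * y powi (j - max m 0)"
      using y by (simp flip: power_int_add)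
    finally show "(x / 2) ^ (2 * nat j) * of_real q ^ nat j
        * (A3 q m n \<nu> (j + min m 0) - B3 q m n \<nu> (j - max m 0))
      = qpoch v q (m + 1) * y powi max m 0
      * (fls_nth (casoratian q v m n) (j - max m 0) * y powi (j - max m 0))"
      unfolding 1 by simp
  qed simp
  also have "\<dots> = qpoch v q (m + 1) * y powi max m 0 * (\<Sum>j=0..P3_deg m n.
      fls_nth (casoratian q v m n) (j - max m 0) * y powi (j - max m 0))"
    by (simp add: sum_distrib_left)
  also have "(\<Sum>j=0..P3_deg m n. fls_nth (casoratian q v m n) (j - max m 0) * y powi (j - max m 0))
     = casoratian_sum y m n"
    unfolding casoratian_sum_def
    by (rule sum.reindex_bij_witness[where i = "\<lambda>k. k + max m 0" and j = "\<lambda>k. k - max m 0"]) auto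
  finally show ?thesis .
qed

end

section \<open>The Bessel array\<close>

lemma convergent_prod_qpoch_inf:
  assumes q: "0 < q" "q < 1"
  shows "convergent_prod (\<lambda>i. 1 - a * complex_of_real q ^ i)"
proof -
  have "summable (\<lambda>i. norm (1 - a * complex_of_real q ^ i - 1))"
    using q by (auto simp: norm_mult norm_power intro!: summable_mult summable_geometric)
  then show ?thesis
    by (intro abs_convergent_prod_imp_convergent_prod summable_imp_abs_convergent_prod)
qed

lemma qpoch_inf_step:
  assumes q: "0 < q" "q < 1"
  shows "qpoch_inf a q = (1 - a) * qpoch_inf (a * of_real q) q"
proof -
  have "(\<lambda>n. \<Prod>i\<le>n. 1 - a * of_real q * of_real q ^ i) \<longlonglongrightarrow> qpoch_inf (a * of_real q) q"
    unfolding qpoch_inf_def by (rule convergent_prod_LIMSEQ[OF convergent_prod_qpoch_inf[OF q]])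
  then have "(\<lambda>n. (1 - a) * (\<Prod>i\<le>n. 1 - a * of_real q * of_real q ^ i)) \<longlonglongrightarrow> (1 - a) * qpoch_inf (a * of_real q) q"
    by (rule tendsto_mult_left)
  moreover have "(\<lambda>n. \<Prod>i\<le>Suc n. 1 - a * of_real q ^ i) \<longlonglongrightarrow> qpoch_inf a q"
    unfolding qpoch_inf_def
    by (rule LIMSEQ_Suc, rule convergent_prod_LIMSEQ[OF convergent_prod_qpoch_inf[OF q]])
  moreover have "(\<Prod>i\<le>Suc n. 1 - a * of_real q ^ i) = (1 - a) * (\<Prod>i\<le>n. 1 - a * of_real q * of_real q ^ i)" for n
    by (subst prod.atMost_Suc_shift) (simp add: mult_ac)
  ultimately show ?thesis by (simp add: LIMSEQ_unique)
qed

lemma qpoch_inf_split: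
  assumes q: "0 < q" "q < 1"
  shows "qpoch_inf a q = qpoch a q (int n) * qpoch_inf (a * of_real q ^ n) q"
proof (induction n)
  case (Suc n)
  have "qpoch a q (int (Suc n)) = qpoch a q (int n) * (1 - a * of_real q ^ n)"
    using qpoch_plus_1[of q "int n" a] q by (simp add: add.commute)
  then show ?case using Suc qpoch_inf_step[OF q, of "a * of_real q ^ n"] by (simp add: mult_ac)
qed simp

lemma lower_param_ok_iff:
  assumes "0 < q"
  shows "lower_param_ok q b \<longleftrightarrow> (\<forall>k. b * of_real q ^ k \<noteq> 1)"
  using assms by (simp add: lower_param_ok_def power_int_minus field_simps)

lemma qpoch_inf_nonzero:
  assumes q: "0 < q" "q < 1" and "lower_param_ok q a"
  shows "qpoch_inf a q \<noteq> 0"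
  unfolding qpoch_inf_def
  by (rule prodinf_nonzero[OF convergent_prod_qpoch_inf[OF q]])
    (use assms(3) in \<open>simp add: lower_param_ok_iff[OF q(1)]\<close>)

text \<open>Multiplying the \<open>\<^sub>1\<phi>\<^sub>1\<close> series by \<open>(a;q)\<^sub>\<infinity>\<close> turns \<open>1/(a;q)\<^sub>k\<close> into \<open>(a q\<^sup>k;q)\<^sub>\<infinity>\<close>, which makes
  sense for every \<open>a\<close>. Hence the array of these series is defined on the whole lattice, also
  where intermediate lower parameters are inadmissible.\<close>

definition bessel_term :: "real \<Rightarrow> complex \<Rightarrow> complex \<Rightarrow> nat \<Rightarrow> complex" where
  "bessel_term q a y k = (- 1) ^ k * of_real q ^ (k choose 2) * y ^ k
     * qpoch_inf (a * of_real q ^ k) q * qfact_inv q (int k)"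

definition bessel_series :: "real \<Rightarrow> complex \<Rightarrow> complex \<Rightarrow> complex" where
  "bessel_series q a y = (\<Sum>k. bessel_term q a y k)"

lemma Suc_choose_two: "(Suc k choose 2) = (k choose 2) + k"
  by (simp add: numeral_2_eq_2)

lemma qfact_inv_Suc:
  assumes q: "0 < q" "q < 1"
  shows "qfact_inv q (int k) = (1 - of_real q ^ Suc k) * qfact_inv q (int (Suc k))"
proof -
  have e: "int k + 1 = int (Suc k)" by simp
  show ?thesis using qfact_inv_step[OF q, of "int k"] unfolding e by (simp only: power_int_of_nat)
qed

lemma summable_bessel_term:
  assumes q: "0 < q" "q < 1"
  shows "summable (bessel_term q a y)"
proof -
  have q0: "(\<lambda>k. complex_of_real q ^ k) \<longlonglongrightarrow> 0"
    using q by (intro LIMSEQ_power_zero) simp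
  have "\<forall>\<^sub>F k in sequentially. norm (a * complex_of_real q ^ k) < 1 / 2"
    using tendsto_norm[OF tendsto_mult_right_zero[OF q0, of a]] by (rule order_tendstoD(2)) auto
  moreover have "\<forall>\<^sub>F k in sequentially. norm (y * complex_of_real q ^ k) < 1 / 8"
    using tendsto_norm[OF tendsto_mult_right_zero[OF q0, of y]] by (rule order_tendstoD(2)) auto
  moreover have "\<forall>\<^sub>F k in sequentially. norm (complex_of_real q ^ Suc k) < 1 / 2"
    using tendsto_norm[OF LIMSEQ_Suc[OF q0]] by (rule order_tendstoD(2)) auto
  ultimately have "\<forall>\<^sub>F k in sequentially. norm (bessel_term q a y (Suc k)) \<le> 1 / 2 * norm (bessel_term q a y k)"
  proof eventually_elim
    case (elim k)
    let ?t = "bessel_term q a y"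
    have "qpoch_inf (a * of_real q ^ k) q = (1 - a * of_real q ^ k) * qpoch_inf (a * of_real q ^ Suc k) q"
      using qpoch_inf_step[OF q, of "a * of_real q ^ k"] by (simp add: mult_ac)
    then have "- (y * of_real q ^ k) * ?t k = (1 - a * of_real q ^ k) * (1 - of_real q ^ Suc k) * ?t (Suc k)"
      using qfact_inv_Suc[OF q, of k]
      by (simp add: bessel_term_def Suc_choose_two power_add)
    then have "norm (1 - a * of_real q ^ k) * norm (1 - complex_of_real q ^ Suc k) * norm (?t (Suc k))
       = norm (y * of_real q ^ k) * norm (?t k)"
      by (metis norm_minus_cancel norm_mult)
    also have "\<dots> \<le> 1 / 8 * norm (?t k)"
      using elim by (intro mult_right_mono) auto
    finally have 1: "norm (1 - a * of_real q ^ k) * norm (1 - complex_of_real q ^ Suc k) * norm (?t (Suc k)) \<le> 1 / 8 * norm (?t k)" .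
    have "1 / 2 \<le> norm (1 - a * complex_of_real q ^ k)" "1 / 2 \<le> norm (1 - complex_of_real q ^ Suc k)"
      using elim norm_triangle_ineq2[of 1 "a * complex_of_real q ^ k"] norm_triangle_ineq2[of 1 "complex_of_real q ^ Suc k"]
      by (simp_all only: norm_one)
    then have "1 / 2 * (1 / 2) \<le> norm (1 - a * of_real q ^ k) * norm (1 - complex_of_real q ^ Suc k)"
      by (intro mult_mono) auto
    then have "1 / 2 * (1 / 2) * norm (?t (Suc k))
        \<le> norm (1 - a * of_real q ^ k) * norm (1 - complex_of_real q ^ Suc k) * norm (?t (Suc k))"
      by (intro mult_right_mono) auto
    with 1 show ?case by simp
  qed
  then obtain K where "\<And>k. k \<ge> K \<Longrightarrow> norm (bessel_term q a y (Suc k)) \<le> 1 / 2 * norm (bessel_term q a y k)"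
    by (auto simp: eventually_sequentially)
  then show ?thesis by (intro summable_ratio_test[of "1 / 2" K]) auto
qed

text \<open>Termwise from \<open>(b;q)\<^sub>\<infinity> = (1 - b) (b q;q)\<^sub>\<infinity>\<close> with \<open>b = a q\<^sup>k\<close>.\<close>

lemma bessel_series_parameter:
  assumes q: "0 < q" "q < 1"
  shows "bessel_series q a y = bessel_series q (a * of_real q) y - a * bessel_series q (a * of_real q) (of_real q * y)"
proof -
  note S = summable_bessel_term[OF q]
  have "bessel_term q a y k = bessel_term q (a * of_real q) y k - a * bessel_term q (a * of_real q) (of_real q * y) k" for k
  proof -
    have 1: "qpoch_inf (a * of_real q ^ k) q = (1 - a * of_real q ^ k) * qpoch_inf (a * of_real q * of_real q ^ k) q"
      using qpoch_inf_step[OF q, of "a * of_real q ^ k"] by (simp add: mult_ac)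
    show ?thesis unfolding bessel_term_def 1 by (simp add: power_mult_distrib algebra_simps)
  qed
  then have "bessel_series q a y = (\<Sum>k. bessel_term q (a * of_real q) y k - a * bessel_term q (a * of_real q) (of_real q * y) k)"
    by (simp add: bessel_series_def)
  also have "\<dots> = bessel_series q (a * of_real q) y - a * bessel_series q (a * of_real q) (of_real q * y)"
    unfolding bessel_series_def by (simp add: suminf_diff[symmetric] suminf_mult[symmetric] S summable_mult)
  finally show ?thesis .
qed

text \<open>The factor \<open>1 - q\<^sup>k\<close> in the difference of the terms cancels against \<open>1/(q;q)\<^sub>k\<close> and shifts
  the summation index.\<close>

lemma bessel_series_argument:
  assumes q: "0 < q" "q < 1"
  shows "bessel_series q a y = bessel_series q a (of_real q * y) - y * bessel_series q (a * of_real q) (of_real q * y)"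
proof -
  note S = summable_bessel_term[OF q]
  let ?d = "\<lambda>k. bessel_term q a y k - bessel_term q a (of_real q * y) k"
  have "bessel_series q a y - bessel_series q a (of_real q * y) = suminf ?d"
    unfolding bessel_series_def by (rule suminf_diff[OF S S])
  also have "\<dots> = (\<Sum>k. ?d (Suc k))"
    by (subst suminf_split_head[OF summable_diff[OF S S]]) (simp add: bessel_term_def)
  also have "\<dots> = (\<Sum>k. - y * bessel_term q (a * of_real q) (of_real q * y) k)"
  proof (rule suminf_cong)
    fix k
    have "?d (Suc k) = (- 1) ^ Suc k * of_real q ^ (Suc k choose 2) * y ^ Suc k
        * qpoch_inf (a * of_real q ^ Suc k) q * ((1 - of_real q ^ Suc k) * qfact_inv q (int (Suc k)))"
      by (simp add: bessel_term_def power_mult_distrib algebra_simps)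
    also have "\<dots> = - y * bessel_term q (a * of_real q) (of_real q * y) k"
      unfolding qfact_inv_Suc[OF q, symmetric]
      by (simp add: bessel_term_def Suc_choose_two power_add power_mult_distrib mult_ac)
    finally show "?d (Suc k) = - y * bessel_term q (a * of_real q) (of_real q * y) k" .
  qed
  also have "\<dots> = - y * bessel_series q (a * of_real q) (of_real q * y)"
    unfolding bessel_series_def by (rule suminf_mult[OF S])
  finally show ?thesis by (simp add: algebra_simps)
qed

lemma contiguous_bessel_series:
  assumes q: "0 < q" "q < 1"
  shows "contiguous (of_real q) v y (\<lambda>m n. bessel_series q (v * of_real q powi (m + 1)) (of_real q powi n * y))"
proof -
  have 1: "v * of_real q powi (m + 1 + 1) = v * of_real q powi (m + 1) * of_real q" for m
    using q power_int_add[of "complex_of_real q" "m + 1" 1] by simp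
  have 2: "of_real q powi (n + 1) * y = of_real q * (of_real q powi n * y)" for n
    using q by (simp add: power_int_add)
  show ?thesis
    unfolding contiguous_def 1 2 using bessel_series_parameter[OF q] bessel_series_argument[OF q] by blast
qed

lemma J3_eq_bessel_series:
  assumes q: "0 < q" "q < 1" and ok: "lower_param_ok q (qpow q (\<nu> + 1))"
  shows "J3 q \<nu> x = cpow (x / 2) \<nu> / qpoch_inf (of_real q) q
     * bessel_series q (qpow q (\<nu> + 1)) (of_real q * (x / 2)\<^sup>2)"
proof -
  define b where "b = qpow q (\<nu> + 1)"
  define z where "z = of_real q * (x / 2)\<^sup>2"
  have nz: "qpoch_inf b q \<noteq> 0" using qpoch_inf_nonzero[OF q ok] by (simp add: b_def)
  let ?u = "\<lambda>k. 1 / (qpoch (of_real q) q (int k) * qpoch b q (int k))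
         * ((- 1) ^ k * of_real q ^ (k choose 2)) * z ^ k"
  have t: "bessel_term q b z k = qpoch_inf b q * ?u k" for k
  proof -
    have "qpoch b q (int k) \<noteq> 0" using qpoch_inf_split[OF q, of b k] nz by auto
    then have "qpoch_inf (b * of_real q ^ k) q = qpoch_inf b q / qpoch b q (int k)"
      using qpoch_inf_split[OF q, of b k] by simp
    then show ?thesis by (simp add: bessel_term_def qfact_inv_def mult_ac)
  qed
  have "summable ?u"
    using summable_divide[OF summable_bessel_term[OF q, of b z], of "qpoch_inf b q"] nz unfolding t by simp
  then have "bessel_series q b z = qpoch_inf b q * suminf ?u"
    unfolding bessel_series_def t by (rule suminf_mult)
  moreover have "qhyp [0] [b] q z = suminf ?u"
    unfolding qhyp_def by (simp add: qpoch_def)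
  moreover have "x\<^sup>2 * of_real q / 4 = z" by (simp add: z_def power2_eq_square)
  ultimately show ?thesis
    unfolding J3_def b_def[symmetric] z_def[symmetric] by (simp only: times_divide_eq_left times_divide_eq_right mult_ac)
qed

section \<open>Continuity in the order\<close>

text \<open>Replacing \<open>\<nu>\<close> by \<open>\<nu> + \<epsilon>\<close> with small \<open>\<epsilon> > 0\<close> makes the real part nonintegral, and
  \<open>|q\<^bsup>\<nu>-1\<^esup>| = q\<^bsup>Re \<nu> - 1\<^esup>\<close> is then no integral power of \<open>q\<close>.\<close>

lemma nonresonant_limit:
  fixes f g :: "complex \<Rightarrow> complex"
  assumes q: "0 < q" "q < 1" and f: "isCont f \<nu>" and g: "isCont g \<nu>"
    and eq: "\<And>\<mu>. nonresonant q (qpow q (\<mu> - 1)) \<Longrightarrow> f \<mu> = g \<mu>"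
  shows "f \<nu> = g \<nu>"
proof -
  define \<delta> where "\<delta> = of_int \<lfloor>Re \<nu>\<rfloor> + 1 - Re \<nu>"
  have "\<delta> > 0" unfolding \<delta>_def by linarith
  then have "\<forall>\<^sub>F e in at_right 0. e \<in> {0<..<\<delta>}"
    by (rule eventually_at_right_real)
  then have ev: "\<forall>\<^sub>F e in at_right 0. f (\<nu> + of_real e) = g (\<nu> + of_real e)"
  proof eventually_elim
    case (elim e)
    have "nonresonant q (qpow q (\<nu> + of_real e - 1))"
      unfolding nonresonant_def
    proof (intro conjI allI notI)
      fix k assume "qpow q (\<nu> + of_real e - 1) * of_real q powi k = 1"
      then have "qpow q (\<nu> + of_real e - 1 + of_int k) = 1"
        using qpow_add_int[OF q(1), of "\<nu> + of_real e - 1" k] by simp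
      then have "norm (qpow q (\<nu> + of_real e - 1 + of_int k)) = 1"
        by simp
      then have "q powr (Re \<nu> + e - 1 + of_int k) = 1"
        using q by (subst (asm) norm_powr_real_powr) auto
      then have "Re \<nu> + e - 1 + of_int k = 0"
        using q by (simp add: powr_eq_one_iff_gen)
      then have "Re \<nu> + e = of_int (1 - k)" by simp
      moreover have "of_int \<lfloor>Re \<nu>\<rfloor> < Re \<nu> + e" "Re \<nu> + e < of_int (\<lfloor>Re \<nu>\<rfloor> + 1)"
        using elim of_int_floor_le[of "Re \<nu>"] unfolding \<delta>_def greaterThanLessThan_iff of_int_add of_int_1
        by linarith+
      ultimately have "\<lfloor>Re \<nu>\<rfloor> < 1 - k" "1 - k < \<lfloor>Re \<nu>\<rfloor> + 1"
        by (simp_all only: of_int_less_iff)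
      then show False by linarith
    qed (use q in simp)
    from eq[OF this] show ?case .
  qed
  have "((\<lambda>e. \<nu> + of_real e) \<longlongrightarrow> \<nu>) (at_right 0)"
    by (rule tendsto_eq_intros refl | simp)+
  then have "((\<lambda>e. f (\<nu> + of_real e)) \<longlongrightarrow> f \<nu>) (at_right 0)"
      "((\<lambda>e. g (\<nu> + of_real e)) \<longlongrightarrow> g \<nu>) (at_right 0)"
    using f g by (auto intro: isCont_tendsto_compose)
  then have "((\<lambda>e. g (\<nu> + of_real e)) \<longlongrightarrow> f \<nu>) (at_right 0)"
      "((\<lambda>e. g (\<nu> + of_real e)) \<longlongrightarrow> g \<nu>) (at_right 0)"
    using tendsto_cong[OF ev] by auto
  then show ?thesis by (rule tendsto_unique[rotated]) simp
qed

lemma isCont_qpow: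
  "0 < q \<Longrightarrow> isCont f \<nu> \<Longrightarrow> isCont (\<lambda>\<nu>. qpow q (f \<nu>)) \<nu>"
  by (simp add: powr_def)

lemma isCont_qpoch:
  assumes q: "0 < q" and f: "isCont f \<nu>" and d: "qpoch_defined (f \<nu>) q k"
  shows "isCont (\<lambda>\<nu>. qpoch (f \<nu>) q k) \<nu>"
proof (cases "k \<ge> 0")
  case True
  then show ?thesis by (simp add: qpoch_def) (intro continuous_intros f)
next
  case False
  have "1 - f \<nu> * of_real q powi k * of_real q ^ i \<noteq> 0" if i: "i < nat (- k)" for i
  proof -
    have "of_real q powi k * of_real q ^ i = complex_of_real q powi (- (- k - int i))"
      using q power_int_add[of "complex_of_real q" k "int i"] by (simp add: add.commute)
    moreover have "- k - int i \<in> {1..- k}" using i by auto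
    ultimately show ?thesis using d unfolding qpoch_defined_def by (metis mult.assoc eq_iff_diff_eq_0)
  qed
  then show ?thesis using False
    by (simp add: qpoch_def) (intro continuous_intros f, simp)
qed

lemma qpoch_defined_nonneg: "k \<ge> 0 \<Longrightarrow> qpoch_defined a q k"
  by (simp add: qpoch_defined_def)

lemma qpoch_nonzero_lower_param:
  assumes q: "0 < q" and "lower_param_ok q b" "k \<ge> 0"
  shows "qpoch b q k \<noteq> 0"
  using assms by (simp add: qpoch_def lower_param_ok_iff)

lemma isCont_qhyp_terminating:
  assumes q: "0 < q" "q < 1" and j: "j \<ge> 0"
    and b: "isCont b \<nu>" and c: "isCont c \<nu>" "lower_param_ok q (c \<nu>)"
  shows "isCont (\<lambda>\<nu>. qfact_inv q j * qhyp [of_real q powi (- j), b \<nu>] [c \<nu>] q x) \<nu>"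
  unfolding qhyp_terminating[OF q j]
  by (intro continuous_intros isCont_qpoch q b c qpoch_defined_nonneg)
     (use qpoch_nonzero_lower_param[OF q(1) c(2)] in auto)

lemma isCont_A3:
  assumes q: "0 < q" "q < 1" and d: "A3_defined q m n \<nu> j"
  shows "isCont (\<lambda>\<nu>. A3 q m n \<nu> j) \<nu>"
proof (cases "j \<ge> 0")
  case True
  have eq: "A3 q m n \<nu> j = qpoch (qpow q \<nu>) q m * qpoch (qpow q (\<nu> - 1)) q (m - j)
     * qpow q (of_int ((j - m + 1) * (n - 1) + 1) - of_int n * \<nu>)
     * (qfact_inv q j * qhyp [of_real q powi (- j), qpow q (\<nu> + of_int (m - j - 1))] [qpow q \<nu>] q
         (of_real q powi (j - n + 1)))" for \<nu>
    by (simp add: A3_def qfact_inv_def)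
  show ?thesis unfolding eq
    by (intro continuous_mult isCont_qhyp_terminating isCont_qpoch isCont_qpow q True)
       (use d True in \<open>auto simp: A3_defined_def intro!: continuous_intros\<close>)
next
  case False
  then show ?thesis using q by (simp add: A3_neg)
qed

lemma isCont_B3:
  assumes q: "0 < q" "q < 1" and d: "B3_defined q m n \<nu> j"
  shows "isCont (\<lambda>\<nu>. B3 q m n \<nu> j) \<nu>"
proof (cases "j \<ge> 0")
  case True
  have eq: "B3 q m n \<nu> j = (- 1) powi j * (qpow q (of_int (j * (j + 1)) / 2 - of_int j * \<nu>)
     * (qfact_inv q j * qhyp [of_real q powi (- j), qpow q (\<nu> - of_int j - 1)] [qpow q (\<nu> + of_int m)] q
         (of_real q powi (j + n + 1)))) / qpoch (qpow q (2 - \<nu>)) q j" for \<nu>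
    by (simp add: B3_def qfact_inv_def)
  show ?thesis unfolding eq
    by (intro continuous_mult continuous_divide continuous_const isCont_qhyp_terminating isCont_qpoch
          isCont_qpow q True qpoch_defined_nonneg)
       (use d True in \<open>auto simp: B3_defined_def intro!: continuous_intros\<close>)
next
  case False
  then show ?thesis using q by (simp add: B3_neg)
qed

lemma isCont_P3:
  assumes q: "0 < q" "q < 1" and d: "P3_defined q m n \<nu>"
  shows "isCont (\<lambda>\<nu>. P3 q m n \<nu> x) \<nu>"
  unfolding P3_def
  by (intro continuous_sum continuous_mult continuous_const continuous_diff isCont_A3 isCont_B3 q)
     (use d in \<open>auto simp: P3_defined_def\<close>)

lemma lower_param_ok_qpoch_inf:
  assumes q: "0 < q" "q < 1" and nz: "qpoch_inf a q \<noteq> 0"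
  shows "lower_param_ok q a"
  unfolding lower_param_ok_iff[OF q(1)]
proof (intro allI notI)
  fix k assume "a * of_real q ^ k = 1"
  then have "qpoch a q (int (Suc k)) = 0" by (simp add: qpoch_def nat_add_distrib)
  then show False using qpoch_inf_split[OF q, of a "Suc k"] nz by simp
qed

text \<open>For \<open>k < 0\<close> the admissibility of \<open>v q\<^sup>k\<close> keeps the denominator of \<open>(v;q)\<^sub>k\<close> away from zero.\<close>

lemma qpoch_inf_ratio:
  assumes q: "0 < q" "q < 1" and ok: "lower_param_ok q v" "lower_param_ok q (v * of_real q powi k)"
  shows "qpoch_inf v q = qpoch v q k * qpoch_inf (v * of_real q powi k) q"
proof (cases "k \<ge> 0")
  case True
  then show ?thesis using qpoch_inf_split[OF q, of v "nat k"] by (simp add: power_int_def)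
next
  case False
  define b where "b = v * of_real q powi k"
  have "complex_of_real q powi k * of_real q powi (- k) = 1"
    using q by (simp flip: power_int_add)
  moreover have "complex_of_real q powi (- k) = of_real q ^ nat (- k)"
    using False by (simp add: power_int_def)
  ultimately have "v = b * of_real q ^ nat (- k)"
    by (simp add: b_def)
  then have "qpoch_inf b q = qpoch b q (- k) * qpoch_inf v q"
    using qpoch_inf_split[OF q, of b "nat (- k)"] False by simp
  moreover have "qpoch v q k * qpoch b q (- k) = 1"
  proof -
    have "qpoch b q (- k) \<noteq> 0"
      using False ok(2) by (intro qpoch_nonzero_lower_param q) (auto simp: b_def)
    moreover have "qpoch v q k = 1 / qpoch b q (- k)"
      using False by (simp add: qpoch_def b_def)
    ultimately show ?thesis by simp
  qed
  ultimately show ?thesis by (simp add: b_def[symmetric] mult.assoc[symmetric])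
qed

section \<open>The three-term relation\<close>

lemma fundamental_isCont:
  assumes "fundamental Q y m n \<alpha> \<beta>" "isCont f \<nu>" "f \<nu> \<noteq> 0"
  shows "isCont (\<lambda>\<nu>. \<alpha> (f \<nu>)) \<nu>" "isCont (\<lambda>\<nu>. \<beta> (f \<nu>)) \<nu>"
proof -
  have "isCont \<alpha> (f \<nu>)" "isCont \<beta> (f \<nu>)"
    using assms unfolding fundamental_def by (auto simp: continuous_on_eq_continuous_at open_Compl)
  with assms(2) show "isCont (\<lambda>\<nu>. \<alpha> (f \<nu>)) \<nu>" "isCont (\<lambda>\<nu>. \<beta> (f \<nu>)) \<nu>"
    by (auto intro: isCont_o2)
qed

text \<open>Both sides solve the system with the same initial values. For \<open>\<beta>\<close> the Casoratian is taken with
  parameter \<open>v q\<close> and shifted by one in \<open>m\<close>, which moves its zero from \<open>(0,0)\<close> to \<open>(1,0)\<close>.\<close>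

lemma fundamental_eq_casoratian_sum:
  assumes q: "0 < q" "q < 1" and v: "nonresonant q v" and y: "y \<noteq> 0"
    and F: "fundamental (of_real q) y m n \<alpha> \<beta>"
  shows "\<alpha> v = y / of_real q * casoratian_sum q v y m n"
    and "\<beta> v = - casoratian_sum q (v * of_real q) y (m - 1) n"
proof -
  have v0: "v \<noteq> 0" using v by (simp add: nonresonant_def)
  have F': "G m n = \<alpha> v * G 1 0 + \<beta> v * G 0 0" if "contiguous (of_real q) v y G" for G
    using F v0 that unfolding fundamental_def by blast
  have "contiguous (of_real q) v y (\<lambda>m n. y / of_real q * casoratian_sum q v y m n)"
    using contiguous_casoratian_sum[OF q v y] unfolding contiguous_def
    by (metis (no_types, lifting) mult.left_commute right_diff_distrib)
  from F'[OF this] show "\<alpha> v = y / of_real q * casoratian_sum q v y m n"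
    using q y by (simp add: casoratian_sum_0_0[OF q v] casoratian_sum_1_0[OF q v])
  have v': "nonresonant q (v * of_real q)" using nonresonant_mult_power[OF v, of 1] q by simp
  let ?w = "casoratian_sum q (v * of_real q) y"
  have c: "contiguous (of_real q) (v * of_real q) y ?w"
    by (rule contiguous_casoratian_sum[OF q v' y])
  have "contiguous (of_real q) v y (\<lambda>m n. - ?w (m - 1) n)"
    unfolding contiguous_def
  proof (intro conjI allI)
    fix m n
    have "?w (m - 1) n = ?w (m - 1 + 1) n - v * of_real q * of_real q powi (m - 1 + 1) * ?w (m - 1 + 1) (n + 1)"
      using c unfolding contiguous_def by blast
    then show "- ?w (m - 1) n = - ?w (m + 1 - 1) n - v * of_real q powi (m + 1) * - ?w (m + 1 - 1) (n + 1)"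
      using q by (simp add: power_int_add)
    have "?w (m - 1) n = ?w (m - 1) (n + 1) - of_real q powi n * y * ?w (m - 1 + 1) (n + 1)"
      using c unfolding contiguous_def by blast
    then show "- ?w (m - 1) n = - ?w (m - 1) (n + 1) - of_real q powi n * y * - ?w (m + 1 - 1) (n + 1)"
      by simp
  qed
  from F'[OF this] show "\<beta> v = - ?w (m - 1) n"
    using y by (simp add: casoratian_sum_0_0[OF q v'] casoratian_sum_m1_0[OF q v'])
qed

text \<open>This is why the two coefficients of the three-term relation are the same \<open>R\<close> with shifted
  arguments.\<close>

lemma fundamental_shift:
  assumes q: "0 < q" "q < 1" and y: "y \<noteq> 0"
    and F: "fundamental (of_real q) y (m + 1) n \<alpha> \<beta>" and F': "fundamental (of_real q) y m n \<alpha>' \<beta>'"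
  shows "\<beta> (qpow q (\<nu> - 1)) = - of_real q / y * \<alpha>' (qpow q \<nu>)"
proof (rule nonresonant_limit[OF q, where f = "\<lambda>\<nu>. \<beta> (qpow q (\<nu> - 1))"
      and g = "\<lambda>\<nu>. - of_real q / y * \<alpha>' (qpow q \<nu>)"])
  show "isCont (\<lambda>\<nu>. \<beta> (qpow q (\<nu> - 1))) \<nu>"
    by (rule fundamental_isCont(2)[OF F]) (use q in \<open>auto intro!: isCont_qpow continuous_intros\<close>)
  show "isCont (\<lambda>\<nu>. - of_real q / y * \<alpha>' (qpow q \<nu>)) \<nu>"
    by (intro continuous_mult continuous_const fundamental_isCont(1)[OF F'])
      (use q in \<open>auto intro!: isCont_qpow continuous_intros\<close>)
  fix \<mu> assume v: "nonresonant q (qpow q (\<mu> - 1))"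
  have e: "qpow q \<mu> = qpow q (\<mu> - 1) * of_real q"
    using qpow_add_int[OF q(1), of "\<mu> - 1" 1] by simp
  have v': "nonresonant q (qpow q \<mu>)"
    using nonresonant_mult_power[OF v, of 1] q unfolding e by simp
  show "\<beta> (qpow q (\<mu> - 1)) = - of_real q / y * \<alpha>' (qpow q \<mu>)"
    using fundamental_eq_casoratian_sum(2)[OF q v y F] fundamental_eq_casoratian_sum(1)[OF q v' y F'] q y
    by (simp add: e)
qed

text \<open>The quotient of infinite products in \<open>R\<close> is \<open>1/(v;q)\<^bsub>m+2\<^esub>\<close> and cancels the factor that
  relates \<open>P\<close> to the Casoratian. The remaining powers of \<open>x/2\<close> combine to \<open>(x/2)\<^sup>m\<close>, the ratio of
  the leading factors of \<open>J\<^bsub>\<nu>+m\<^esub>\<close> and \<open>J\<^sub>\<nu>\<close>. The two sides are compared at nearby nonresonant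
  parameters first.\<close>

lemma R3_eq_fundamental:
  assumes q: "0 < q" "q < 1" and x: "x \<noteq> 0"
    and d: "R3_defined q m n \<nu> x" and ok: "lower_param_ok q (qpow q (\<nu> + of_int m + 1))"
    and F: "fundamental (of_real q) (of_real q * (x / 2)\<^sup>2) (m + 1) n \<alpha> \<beta>"
  shows "R3 q m n \<nu> x = \<alpha> (qpow q (\<nu> - 1)) * (x / 2) powi m"
proof -
  define h where "h = x / 2"
  define y where "y = of_real q * h\<^sup>2"
  define M where "M = max (m + 1) 0"
  define v where "v = qpow q (\<nu> - 1)"
  have h: "h \<noteq> 0" and y: "y \<noteq> 0" and q0: "complex_of_real q \<noteq> 0" using x q by (auto simp: h_def y_def)
  have vm: "v * of_real q powi (m + 2) = qpow q (\<nu> + of_int m + 1)"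
    using qpow_add_int[OF q(1), of "\<nu> - 1" "m + 2"] by (simp add: v_def add_ac)
  have okm: "lower_param_ok q (v * of_real q powi (m + 2))" using ok by (simp add: vm)
  have nz: "qpoch_inf v q \<noteq> 0" using d by (simp add: R3_defined_def v_def)
  have okv: "lower_param_ok q v" by (rule lower_param_ok_qpoch_inf[OF q nz])
  have def: "qpoch_defined v q (m + 2)"
    unfolding qpoch_defined_def
  proof
    fix i assume i: "i \<in> {1..- (m + 2)}"
    have "v * of_real q powi (m + 2) * of_real q ^ nat (- m - 2 - i) \<noteq> 1"
      using okm unfolding lower_param_ok_iff[OF q(1)] by blast
    moreover have "of_real q powi (m + 2) * of_real q ^ nat (- m - 2 - i) = complex_of_real q powi (- i)"
      using q i power_int_add[of "complex_of_real q" "m + 2" "- m - 2 - i"]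
      by (simp add: power_int_def)
    ultimately show "v * of_real q powi (- i) \<noteq> 1" by (simp add: mult.assoc)
  qed
  have "of_real q * (qpoch v q (m + 2) * y powi M) * \<alpha> v = y * P3 q (m + 1) n \<nu> x"
    unfolding v_def
  proof (rule nonresonant_limit[OF q,
        where f = "\<lambda>\<nu>. of_real q * (qpoch (qpow q (\<nu> - 1)) q (m + 2) * y powi M) * \<alpha> (qpow q (\<nu> - 1))"
          and g = "\<lambda>\<nu>. y * P3 q (m + 1) n \<nu> x"])
    show "isCont (\<lambda>\<nu>. of_real q * (qpoch (qpow q (\<nu> - 1)) q (m + 2) * y powi M) * \<alpha> (qpow q (\<nu> - 1))) \<nu>"
      by (intro continuous_mult continuous_const isCont_qpoch fundamental_isCont(1)[OF F] isCont_qpow q)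
        (use q def in \<open>auto simp: v_def intro!: continuous_intros\<close>)
    show "isCont (\<lambda>\<nu>. y * P3 q (m + 1) n \<nu> x) \<nu>"
      using d by (intro continuous_mult continuous_const isCont_P3 q) (simp add: R3_defined_def)
    fix \<mu> assume v: "nonresonant q (qpow q (\<mu> - 1))"
    show "of_real q * (qpoch (qpow q (\<mu> - 1)) q (m + 2) * y powi M) * \<alpha> (qpow q (\<mu> - 1)) = y * P3 q (m + 1) n \<mu> x"
      using P3_eq_casoratian_sum[OF q v refl x, of "m + 1" n]
        fundamental_eq_casoratian_sum(1)[OF q v y F[folded h_def, folded y_def]] q0
      by (simp add: y_def h_def M_def mult_ac add.commute)
  qed
  then have P: "P3 q (m + 1) n \<nu> x = of_real q / y * y powi M * qpoch v q (m + 2) * \<alpha> v"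
    using y by (simp add: field_simps)
  have "qpoch_inf v q = qpoch v q (m + 2) * qpoch_inf (v * of_real q powi (m + 2)) q"
    by (rule qpoch_inf_ratio[OF q okv okm])
  then have ratio: "qpoch_inf (qpow q (\<nu> + of_int m + 1)) q / qpoch_inf v q * qpoch v q (m + 2) = 1"
    using nz by (simp add: vm[symmetric])
  have pw: "of_real q powi (- M) * h powi (min (m + 2) (- m)) * (of_real q / y * y powi M) = h powi m"
  proof -
    have "of_real q / y = h powi (- 2)" using q0 by (simp add: y_def power_int_minus divide_inverse)
    moreover have "of_real q powi (- M) * y powi M = h powi (2 * M)"
      using q0 by (simp add: y_def power_int_mult_distrib power_int_minus power_int_mult)
    ultimately have "of_real q powi (- M) * h powi (min (m + 2) (- m)) * (of_real q / y * y powi M)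
      = h powi (2 * M) * h powi (min (m + 2) (- m)) * h powi (- 2)"
      by (simp add: mult_ac)
    also have "\<dots> = h powi (2 * M + min (m + 2) (- m) + - 2)"
      by (simp only: power_int_add[OF disjI1[OF h]])
    also have "2 * M + min (m + 2) (- m) + - 2 = m"
      by (simp add: M_def max_def min_def)
    finally show ?thesis .
  qed
  have "R3 q m n \<nu> x = (qpoch_inf (qpow q (\<nu> + of_int m + 1)) q / qpoch_inf v q * qpoch v q (m + 2))
     * (of_real q powi (- M) * h powi (min (m + 2) (- m)) * (of_real q / y * y powi M)) * \<alpha> v"
    unfolding R3_def P by (simp add: v_def h_def M_def mult_ac)
  also have "\<dots> = \<alpha> v * h powi m"
    unfolding ratio pw by simp
  finally show ?thesis by (simp add: v_def h_def)
qed

lemma J3_three_term: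
  assumes q: "0 < q" "q < 1" and x: "x \<noteq> 0"
    and Jm: "J3_defined q (\<nu> + of_int m) (x * qpow q (of_int n / 2))"
    and J0: "J3_defined q \<nu> x" and J1: "J3_defined q (\<nu> - 1) x"
    and R0: "R3_defined q m n \<nu> x" and R1: "R3_defined q (m - 1) n (\<nu> + 1) x"
  shows "qpow q (- ((\<nu> + of_int m) * of_int n / 2))
                * J3 q (\<nu> + of_int m) (x * qpow q (of_int n / 2))
              = R3 q m n \<nu> x * J3 q \<nu> x - R3 q (m - 1) n (\<nu> + 1) x * J3 q (\<nu> - 1) x"
proof -
  define h where "h = x / 2"
  define y where "y = of_real q * h\<^sup>2"
  define v where "v = qpow q (\<nu> - 1)"
  define c where "c = qpoch_inf (complex_of_real q) q"
  define B where "B m n = bessel_series q (v * of_real q powi (m + 1)) (of_real q powi n * y)" for m n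
  have h: "h \<noteq> 0" and y: "y \<noteq> 0" and q0: "complex_of_real q \<noteq> 0" and v0: "v \<noteq> 0"
    using x q by (auto simp: h_def y_def v_def)
  have qp: "qpow q (\<nu> + of_int k) = v * of_real q powi (k + 1)" for k
    using qpow_add_int[OF q(1), of "\<nu> - 1" "k + 1"] by (simp add: v_def add_ac)
  have cp: "cpow z \<mu> = z powr \<mu>" if "z \<noteq> 0" for z \<mu>
    using that by (simp add: cpow_def)
  obtain \<alpha> \<beta> where F: "fundamental (of_real q) y (m + 1) n \<alpha> \<beta>"
    using fundamental_exists[OF q0 y] by blast
  obtain \<alpha>' \<beta>' where F': "fundamental (of_real q) y m n \<alpha>' \<beta>'"
    using fundamental_exists[OF q0 y] by blast
  have rel: "B (m + 1) n = \<alpha> v * B 1 0 + \<beta> v * B 0 0"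
    using F v0 contiguous_bessel_series[OF q, of v y] unfolding fundamental_def B_def by blast
  have ok: "lower_param_ok q (qpow q (\<nu> + of_int m + 1))"
    using Jm by (simp add: J3_defined_def)
  have R: "R3 q m n \<nu> x = \<alpha> v * h powi m"
    using R3_eq_fundamental[OF q x R0 ok] F by (simp add: y_def h_def v_def)
  have R': "R3 q (m - 1) n (\<nu> + 1) x = \<alpha>' (qpow q \<nu>) * h powi (m - 1)"
    using R3_eq_fundamental[OF q x R1] ok F' by (simp add: y_def h_def)
  have \<beta>: "\<beta> v = - (\<alpha>' (qpow q \<nu>) / h\<^sup>2)"
    using fundamental_shift[OF q y F F', of \<nu>] q0 by (simp add: v_def y_def)
  have J: "J3 q \<nu> x = h powr \<nu> / c * B 1 0"
    using J3_eq_bessel_series[OF q, of \<nu> x] J0 qp[of 1] h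
    by (simp add: J3_defined_def B_def c_def y_def h_def cp)
  have J': "J3 q (\<nu> - 1) x = h powr (\<nu> - 1) / c * B 0 0"
    using J3_eq_bessel_series[OF q, of "\<nu> - 1" x] J1 qp[of 0] h
    by (simp add: J3_defined_def B_def c_def y_def h_def cp)
  define s where "s = qpow q (of_int n / 2)"
  have s0: "s \<noteq> 0" using q by (simp add: s_def)
  have s2: "s\<^sup>2 = of_real q powi n"
    using qpow_of_int[OF q(1), of n] qpow_add[of q "of_int n / 2" "of_int n / 2"]
    by (simp add: s_def power2_eq_square)
  have s: "s = of_real (q powr (of_int n / 2))"
    unfolding s_def using q by (simp add: powr_of_real[symmetric])
  have sp: "s powr (\<nu> + of_int m) = qpow q ((\<nu> + of_int m) * of_int n / 2)"
  proof -
    have L: "Ln s = of_real (of_int n / 2 * ln q)"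
      unfolding s using q by (subst Ln_of_real) (simp_all add: ln_powr)
    show ?thesis using s0 q by (simp add: powr_def Ln_of_real L mult.assoc)
  qed
  have hs: "(x * s / 2) powr \<mu> = h powr \<mu> * s powr \<mu>" for \<mu>
  proof -
    have e: "x * s / 2 = s * h" by (simp add: h_def)
    have "s \<in> \<real>" "Re s \<ge> 0" by (simp_all add: s)
    then show ?thesis unfolding e by (subst powr_times_real_left) (simp_all add: mult.commute)
  qed
  have Jm': "J3 q (\<nu> + of_int m) (x * s) = (x * s / 2) powr (\<nu> + of_int m) / c * B (m + 1) n"
  proof -
    have "of_real q * (x * s / 2)\<^sup>2 = of_real q powi n * y"
      by (simp add: y_def h_def s2[symmetric] power_mult_distrib power_divide)
    moreover have "qpow q (\<nu> + of_int m + 1) = v * of_real q powi (m + 1 + 1)"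
      using qp[of "m + 1"] by (simp add: add_ac)
    ultimately show ?thesis
      using J3_eq_bessel_series[OF q ok, of "x * s"] x s0 by (simp add: B_def c_def cp)
  qed
  have "qpow q (- ((\<nu> + of_int m) * of_int n / 2)) * s powr (\<nu> + of_int m) = 1"
    unfolding sp qpow_add[symmetric] using q by simp
  then have "qpow q (- ((\<nu> + of_int m) * of_int n / 2)) * J3 q (\<nu> + of_int m) (x * s)
      = h powr (\<nu> + of_int m) / c * B (m + 1) n"
    unfolding Jm' hs by (simp add: mult_ac)
  also have "\<dots> = R3 q m n \<nu> x * J3 q \<nu> x - R3 q (m - 1) n (\<nu> + 1) x * J3 q (\<nu> - 1) x"
  proof -
    have hp: "h powr (\<nu> + of_int m) = h powi m * h powr \<nu>"
      using h by (simp add: powr_add complex_powr_of_int mult.commute)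
    have hp': "h powr (\<nu> + of_int m) / h\<^sup>2 = h powi (m - 1) * h powr (\<nu> - 1)"
      unfolding hp using h by (simp add: powr_diff power_int_diff power2_eq_square)
    have "h powr (\<nu> + of_int m) / c * B (m + 1) n
      = h powr (\<nu> + of_int m) * \<alpha> v * B 1 0 / c - (h powr (\<nu> + of_int m) / h\<^sup>2) * \<alpha>' (qpow q \<nu>) * B 0 0 / c"
      unfolding rel \<beta> by (simp add: diff_divide_distrib algebra_simps)
    also have "\<dots> = R3 q m n \<nu> x * J3 q \<nu> x - R3 q (m - 1) n (\<nu> + 1) x * J3 q (\<nu> - 1) x"
      unfolding hp' unfolding hp R R' J J' by (simp add: mult_ac)
    finally show ?thesis .
  qed
  finally show ?thesis by (simp only: s_def)
qed

text \<open>At the origin both sides of the three-term relation vanish. The denominator of \<open>R\<close> excludes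
  \<open>\<nu> = 1\<close>, so \<open>J\<^bsub>\<nu>-1\<^esub>\<close> can only be defined there if \<open>Re \<nu> > 1\<close>; the powers of \<open>x/2\<close> in the
  two coefficients force \<open>m \<ge> - 1\<close>. Hence all three orders have positive real part.\<close>

lemma J3_three_term_origin:
  assumes q: "0 < q" "q < 1"
    and J1: "J3_defined q (\<nu> - 1) 0"
    and R0: "R3_defined q m n \<nu> 0" and R1: "R3_defined q (m - 1) n (\<nu> + 1) 0"
  shows "J3 q (\<nu> + of_int m) 0 = 0" "J3 q \<nu> 0 = 0" "J3 q (\<nu> - 1) 0 = 0"
proof -
  have "lower_param_ok q (qpow q (\<nu> - 1))"
    using R0 by (intro lower_param_ok_qpoch_inf q) (simp add: R3_defined_def)
  then have "qpow q (\<nu> - 1) \<noteq> 1"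
    unfolding lower_param_ok_iff[OF q(1)] by (metis mult.right_neutral power_0)
  then have "\<nu> - 1 \<noteq> 0" using q by auto
  then have "Re (\<nu> - 1) > 0" using J1 by (auto simp: J3_defined_def)
  moreover have "m \<ge> - 1" using R1 R0 by (auto simp: R3_defined_def)
  ultimately have "\<nu> - 1 \<noteq> 0" "\<nu> \<noteq> 0" "Re (\<nu> + of_int m) > 0" by auto
  then have "\<nu> + of_int m \<noteq> 0" by (metis less_irrefl zero_complex.sel(1))
  with \<open>\<nu> - 1 \<noteq> 0\<close> \<open>\<nu> \<noteq> 0\<close>
  show "J3 q (\<nu> + of_int m) 0 = 0" "J3 q \<nu> 0 = 0" "J3 q (\<nu> - 1) 0 = 0"
    by (simp_all add: J3_def cpow_def)
qed

lemma P3_polynomial: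
  "\<exists>p :: complex poly. (\<forall>y. P3 q m n \<nu> y = poly p (y\<^sup>2)) \<and> (p = 0 \<or> int (degree p) \<le> P3_deg m n)"
proof -
  define a where "a j = of_real q ^ nat j * (A3 q m n \<nu> (j + min m 0) - B3 q m n \<nu> (j - max m 0)) / 4 ^ nat j" for j
  define p where "p = (\<Sum>j\<in>{0..P3_deg m n}. monom (a j) (nat j))"
  have "P3 q m n \<nu> y = poly p (y\<^sup>2)" for y
    unfolding P3_def p_def poly_sum poly_monom a_def
    by (intro sum.cong) (simp_all add: power_mult power_divide)
  moreover have "p = 0 \<or> int (degree p) \<le> P3_deg m n"
  proof (cases "P3_deg m n \<ge> 0")
    case True
    have "degree p \<le> nat (P3_deg m n)"
      unfolding p_def
    proof (rule degree_sum_le)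
      fix j assume "j \<in> {0..P3_deg m n}"
      then have "nat j \<le> nat (P3_deg m n)" by (simp add: nat_mono)
      then show "degree (monom (a j) (nat j)) \<le> nat (P3_deg m n)"
        using degree_monom_le order_trans by blast
    qed simp
    then show ?thesis using True nat_le_iff by (simp add: le_nat_iff)
  qed (simp add: p_def)
  ultimately show ?thesis by blast
qed

theorem theorem4:
  fixes q :: real and \<nu> x :: complex and m n :: int
  assumes "0 < q" "q < 1"
  shows "(J3_defined q (\<nu> + of_int m) (x * qpow q (of_int n / 2))
          \<and> J3_defined q \<nu> x \<and> J3_defined q (\<nu> - 1) x
          \<and> R3_defined q m n \<nu> x \<and> R3_defined q (m - 1) n (\<nu> + 1) x
          \<longrightarrow> qpow q (- ((\<nu> + of_int m) * of_int n / 2))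
                * J3 q (\<nu> + of_int m) (x * qpow q (of_int n / 2))
              = R3 q m n \<nu> x * J3 q \<nu> x - R3 q (m - 1) n (\<nu> + 1) x * J3 q (\<nu> - 1) x)
       \<and> (P3_defined q m n \<nu>
          \<longrightarrow> (\<exists>p :: complex poly. (\<forall>y. P3 q m n \<nu> y = poly p (y\<^sup>2))
                 \<and> (p = 0 \<or> int (degree p) \<le> max \<bar>n\<bar> \<bar>m - n\<bar> - 1)))"
proof (intro conjI impI)
  assume H: "J3_defined q (\<nu> + of_int m) (x * qpow q (of_int n / 2))
          \<and> J3_defined q \<nu> x \<and> J3_defined q (\<nu> - 1) x
          \<and> R3_defined q m n \<nu> x \<and> R3_defined q (m - 1) n (\<nu> + 1) x"
  show "qpow q (- ((\<nu> + of_int m) * of_int n / 2))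
                * J3 q (\<nu> + of_int m) (x * qpow q (of_int n / 2))
              = R3 q m n \<nu> x * J3 q \<nu> x - R3 q (m - 1) n (\<nu> + 1) x * J3 q (\<nu> - 1) x"
  proof (cases "x = 0")
    case True
    then show ?thesis using J3_three_term_origin[OF assms, where \<nu> = \<nu> and m = m and n = n] H by simp
  next
    case False
    then show ?thesis using J3_three_term[OF assms] H by blast
  qed
next
  show "\<exists>p :: complex poly. (\<forall>y. P3 q m n \<nu> y = poly p (y\<^sup>2))
                 \<and> (p = 0 \<or> int (degree p) \<le> max \<bar>n\<bar> \<bar>m - n\<bar> - 1)"
    using P3_polynomial[of q m n \<nu>] by (simp only: P3_deg_def)
qed

end
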